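(* Suppose that $\Omega\subset\mathbb{R}^d$ is compact and convex, and that $\mu,\nu\in\mathcal{P}(\Omega)$. Suppose that $\mu\ll\mathcal{L}_d$, and that $\lambda>0$ satisfies $$\operatorname*{ess\,inf}_{\mu}\,|x-T_0(x)|>\lambda,$$ where $T_0$ is the unique ray monotone optimal transport map for $W_1(\mu,\nu)$. Take $u_0\in 1\text{-Lip}(\Omega)$ a Kantorovich potential for $W_1(\mu,\nu)$, and let $T$ be a Borel map equal to $I-\nabla(-\lambda u_0)^{c_2}$ $\mu$-almost everywhere. Then $\rho_\lambda:=T_\#\mu$ is the unique solution to $$\inf_{\rho\in\mathcal{P}(\Omega)}\ \frac12W_2^2(\mu,\rho)+\lambda W_1(\rho,\nu).$$
   Context: $\mathcal{P}(\Omega)$ is the set of Borel probability measures on $\Omega$, $\mathcal{L}_d$ is Lebesgue measure, $I$ is the identity map, and $W_p$ is the Wasserstein $p$ distance for the Euclidean distance. $1\text{-Lip}(\Omega)$ is the set of functions on $\Omega$ with Lipschitz constant at most $1$. A Kantorovich potential for $W_1(\mu,\nu)$ is a maximizer of $\sup_{u\in1\text{-Lip}(\Omega)}\int_\Omega u\,d\mu-\int_\Omega u\,d\nu$. With $c_2(x,y)=\frac12|x-y|^2$, $(-\lambda u_0)^{c_2}(x)=\inf_{y\in\Omega}\big(\frac12|x-y|^2+\lambda u_0(y)\big)$. The ray monotone optimal transport map $T_0$ for $W_1(\mu,\nu)$ is the ($\mu$-a.e. unique, as $\mu\ll\mathcal{L}_d$) optimal transport map from $\mu$ to $\nu$ for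 the cost $|x-y|$ that is monotone non-decreasing along each transport ray of a Kantorovich potential; equivalently, $(I,T_0)_\#\mu$ is the unique minimizer of $\int|x-y|^2\,d\gamma$ among all transport plans $\gamma$ from $\mu$ to $\nu$ that are optimal for the cost $|x-y|$. (A transport ray of a 1-Lipschitz function $u$ is a maximal non-trivial segment $[x,y]$ with $u(x)-u(y)=|x-y|$.) The essential infimum is with respect to $\mu$. *)

theory Defs
  imports "HOL-Probability.Probability"
begin

text \<open>
  Measures on \<open>\<Omega>\<close> are represented as Borel measures on the whole Euclidean space that are
  concentrated on \<open>\<Omega>\<close>.  Everything below is used for compact \<open>\<Omega>\<close> only, so that all the
  Bochner integrals of costs are integrals of integrable functions and all the infima of real
  numbers are infima of nonempty sets that are bounded below.
\<close>

definition prob_measures_on :: "'a::euclidean_space set \<Rightarrow> 'a measure set" where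
  "prob_measures_on \<Omega> = {\<mu>. sets \<mu> = sets borel \<and> prob_space \<mu> \<and> emeasure \<mu> \<Omega> = 1}"

definition transport_plans ::
    "'a::euclidean_space measure \<Rightarrow> 'a measure \<Rightarrow> ('a \<times> 'a) measure set" where
  "transport_plans \<mu> \<nu> =
     {\<gamma>. sets \<gamma> = sets borel \<and> distr \<gamma> borel fst = \<mu> \<and> distr \<gamma> borel snd = \<nu>}"

definition wasserstein ::
    "real \<Rightarrow> 'a::euclidean_space measure \<Rightarrow> 'a measure \<Rightarrow> real" where
  "wasserstein p \<mu> \<nu> =
     (INF \<gamma>\<in>transport_plans \<mu> \<nu>. LINT z|\<gamma>. dist (fst z) (snd z) powr p) powr (1 / p)"

definition kantorovich_potential ::
    "'a::euclidean_space set \<Rightarrow> 'a measure \<Rightarrow> 'a measure \<Rightarrow> ('a \<Rightarrow> real) \<Rightarrow> bool" where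
  "kantorovich_potential \<Omega> \<mu> \<nu> u \<longleftrightarrow>
     is_arg_max (\<lambda>v. (LINT x:\<Omega>|\<mu>. v x) - (LINT x:\<Omega>|\<nu>. v x)) (\<lambda>v. 1-lipschitz_on \<Omega> v) u"

definition c2_transform ::
    "'a::euclidean_space set \<Rightarrow> ('a \<Rightarrow> real) \<Rightarrow> 'a \<Rightarrow> real" where
  "c2_transform \<Omega> f x = (INF y\<in>\<Omega>. 1/2 * (norm (x - y))\<^sup>2 - f y)"

text \<open>
  The gradient as a total function: at points where \<open>f\<close> is not differentiable its value is
  unspecified.
\<close>

definition gradient :: "('a::euclidean_space \<Rightarrow> real) \<Rightarrow> 'a \<Rightarrow> 'a" where
  "gradient f x = (THE D. GDERIV f x :> D)"

definition transport_segment ::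
    "'a::euclidean_space set \<Rightarrow> ('a \<Rightarrow> real) \<Rightarrow> 'a set \<Rightarrow> bool" where
  "transport_segment \<Omega> u R \<longleftrightarrow>
     (\<exists>x\<in>\<Omega>. \<exists>y\<in>\<Omega>. x \<noteq> y \<and> u x - u y = norm (x - y) \<and> R = closed_segment x y)"

definition transport_ray ::
    "'a::euclidean_space set \<Rightarrow> ('a \<Rightarrow> real) \<Rightarrow> 'a set \<Rightarrow> bool" where
  "transport_ray \<Omega> u R \<longleftrightarrow>
     transport_segment \<Omega> u R \<and> (\<forall>S. transport_segment \<Omega> u S \<longrightarrow> R \<subseteq> S \<longrightarrow> R = S)"

definition optimal_map_W1 ::
    "'a::euclidean_space measure \<Rightarrow> 'a measure \<Rightarrow> ('a \<Rightarrow> 'a) \<Rightarrow> bool" where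
  "optimal_map_W1 \<mu> \<nu> S \<longleftrightarrow>
     S \<in> borel_measurable borel \<and> distr \<mu> borel S = \<nu> \<and>
     is_arg_min (\<lambda>\<gamma>. LINT z|\<gamma>. norm (fst z - snd z)) (\<lambda>\<gamma>. \<gamma> \<in> transport_plans \<mu> \<nu>)
       (distr \<mu> borel (\<lambda>x. (x, S x)))"

text \<open>
  An optimal map is only determined almost everywhere, so monotonicity along the rays is required
  only on a set \<open>A\<close> of full measure.  For almost every \<open>x\<close>, an optimal map sends \<open>x\<close> into the
  transport ray through \<open>x\<close>, and for two points and two images on one line the sign of the inner
  product says precisely that their order is preserved.
\<close>

definition ray_monotone_map ::
    "'a::euclidean_space set \<Rightarrow> 'a measure \<Rightarrow> 'a measure \<Rightarrow> ('a \<Rightarrow> 'a) \<Rightarrow> bool" where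
  "ray_monotone_map \<Omega> \<mu> \<nu> S \<longleftrightarrow>
     optimal_map_W1 \<mu> \<nu> S \<and>
     (\<exists>u A. kantorovich_potential \<Omega> \<mu> \<nu> u \<and> (AE x in \<mu>. x \<in> A) \<and>
        (\<forall>R. transport_ray \<Omega> u R \<longrightarrow>
           (\<forall>x\<in>R \<inter> A. \<forall>y\<in>R \<inter> A. (S x - S y) \<bullet> (x - y) \<ge> 0)))"

definition essinf :: "'a measure \<Rightarrow> ('a \<Rightarrow> real) \<Rightarrow> ereal" where
  "essinf M f = Sup {z. AE x in M. z \<le> ereal (f x)}"

end

theory Submission
  imports Defs
begin

text \<open>
  Write \<open>u\<close> for the Kantorovich potential, \<open>f = - \<lambda> u\<close>, and \<open>\<phi> = f\<^sup>c\<close> for its transform. For every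
  \<open>\<rho>\<close> and every plan \<open>\<gamma>\<close> from \<open>\<mu>\<close> to \<open>\<rho>\<close>, the pointwise inequality
  \<open>\<bar>x - y\<bar>\<^sup>2 / 2 \<ge> \<phi> x - \<lambda> u y\<close> and the bound \<open>W\<^sub>1(\<rho>, \<nu>) \<ge> \<integral> u d\<rho> - \<integral> u d\<nu>\<close> add up to a lower bound
  \<open>\<integral> \<phi> d\<mu> - \<lambda> \<integral> u d\<nu>\<close> for the objective in which \<open>\<rho>\<close> no longer occurs. The theorem says that
  \<open>T\<^sub>#\<mu>\<close> attains this bound and that nothing else does (\<open>objective_characterization\<close>).

  The transform is differentiable almost everywhere, and where it is, \<open>x - \<nabla>\<phi> x\<close> is the only
  minimizer of \<open>y \<mapsto> \<bar>x - y\<bar>\<^sup>2 / 2 + \<lambda> u y\<close>. Here this is obtained in the opposite order, without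
  Rademacher's theorem: the points with two minimizers form a countable union of closed
  sets each of which meets every line of some coordinate direction at most once
  (\<open>AE_unique_c2_minimizer\<close>), and uniqueness of the minimizer implies differentiability
  (\<open>GDERIV_c2_transform\<close>). Hence \<open>T x\<close> is the unique minimizer for \<open>\<mu>\<close>-almost every \<open>x\<close>, so the first
  of the two inequalities is an equality for the plan \<open>(I, T)\<^sub>#\<mu>\<close>.

  The assumption on the transport distance is what makes the second inequality an equality. Almost every
  \<open>x\<close> satisfies \<open>u x - u (T\<^sub>0 x) = \<bar>x - T\<^sub>0 x\<bar>\<close> (\<open>optimal_map_saturates_potential\<close>), so \<open>u\<close> drops with
  slope one along the segment from \<open>x\<close> to \<open>T\<^sub>0 x\<close>. As \<open>u\<close> can nowhere drop faster, a cheapest \<open>y\<close> is the point at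
  distance exactly \<open>\<lambda>\<close> along this segment, which exists because the segment is longer than \<open>\<lambda>\<close>
  (\<open>c2_minimizer_on_ray\<close>). So \<open>T x\<close> lies on the segment, \<open>u (T x) - u (T\<^sub>0 x) = \<bar>T x - T\<^sub>0 x\<bar>\<close>, and
  \<open>(T, T\<^sub>0)\<^sub>#\<mu>\<close> is a plan from \<open>T\<^sub>#\<mu>\<close> to \<open>\<nu>\<close> whose cost is \<open>\<integral> u d(T\<^sub>#\<mu>) - \<integral> u d\<nu>\<close>.

  The saturation of \<open>u\<close> rests on Kantorovich duality, that is, on the absence of a gap between
  plans and potentials. It is proved first on finite spaces, where the potential is a shortest path
  distance in the residual graph of a cheapest coupling (\<open>finite_kantorovich_duality\<close>), and then up
  to an arbitrary error on compact sets by rounding points to a finite set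
  (\<open>kantorovich_duality_approx\<close>).

  For uniqueness, let \<open>\<rho>\<close> attain the bound. Plans from \<open>\<mu>\<close> to \<open>\<rho>\<close> that are nearly optimal for \<open>W\<^sub>2\<close> then have a
  nearly vanishing integral of the nonnegative gap in the pointwise inequality, and the gap vanishes only on the graph of
  \<open>T\<close>. So these plans concentrate near that graph, which forces \<open>\<rho> = T\<^sub>#\<mu>\<close>
  (\<open>eq_distr_if_near_optimal_plans\<close>). Working with nearly optimal plans avoids the
  existence of optimal ones, hence any weak compactness of measures.
\<close>

section \<open>Kantorovich duality on finite spaces\<close>

text \<open>
  Fix a coupling and let the list consist of pairs \<open>(x\<^sub>i, y\<^sub>i)\<close> that carry mass. A path in the residual
  graph starts at \<open>z\<close> and sends mass forward from \<open>z\<close> to \<open>y\<^sub>1\<close>, back along the used pair \<open>(x\<^sub>1, y\<^sub>1)\<close> to \<open>x\<^sub>1\<close>,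
  forward to \<open>y\<^sub>2\<close>, and so on, and finally travels from the last \<open>x\<^sub>n\<close> to the root \<open>r\<close>. Forward
  moves pay the distance and backward moves refund it.
\<close>

fun path_cost :: "'a::metric_space \<Rightarrow> 'a \<Rightarrow> ('a \<times> 'a) list \<Rightarrow> real" where
  "path_cost r z [] = dist z r"
| "path_cost r z ((x, y) # l) = dist z y - dist x y + path_cost r x l"

text \<open>
  The change of the coupling effected by one unit of mass that follows such a path, up to \<open>x\<^sub>n\<close>. The
  last leg to the root only serves to anchor the potential.
\<close>

fun reroute :: "'a \<Rightarrow> ('a \<times> 'a) list \<Rightarrow> 'a \<times> 'a \<Rightarrow> real" where
  "reroute z [] pq = 0"
| "reroute z ((x, y) # l) pq =
     (if pq = (z, y) then 1 else 0) - (if pq = (x, y) then 1 else 0) + reroute x l pq"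

fun path_end :: "'a \<Rightarrow> ('a \<times> 'a) list \<Rightarrow> 'a" where
  "path_end z [] = z"
| "path_end z ((x, y) # l) = path_end x l"

lemma path_end_in: "\<lbrakk>z \<in> P; set l \<subseteq> P \<times> P\<rbrakk> \<Longrightarrow> path_end z l \<in> P"
  by (induction z l rule: path_end.induct) auto

text \<open>
  Rerouting preserves the second marginal and moves the first one from the end of the path to its
  start. A closed path therefore leads from couplings to couplings.
\<close>

lemma reroute_row_sum:
  assumes "finite P" "z \<in> P" "set l \<subseteq> P \<times> P" "p \<in> P"
  shows "(\<Sum>q\<in>P. reroute z l (p, q)) = (if p = z then 1 else 0) - (if p = path_end z l then 1 else 0)"
  using assms(2,3)
proof (induction l arbitrary: z)
  case (Cons e l)
  obtain x y where e: "e = (x, y)" by (cases e)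
  have "(\<Sum>q\<in>P. if (p, q) = (w, y) then 1 else 0) = (if p = w then 1 else (0::real))" for w
    using Cons.prems \<open>finite P\<close> e by (cases "p = w") (auto simp: if_distrib)
  then show ?case
    using Cons e by (simp add: sum.distrib sum_subtractf)
qed auto

lemma reroute_column_sum:
  assumes "finite P" "z \<in> P" "set l \<subseteq> P \<times> P" "q \<in> P"
  shows "(\<Sum>p\<in>P. reroute z l (p, q)) = 0"
  using assms(2,3)
proof (induction l arbitrary: z)
  case (Cons e l)
  obtain x y where e: "e = (x, y)" by (cases e)
  have "(\<Sum>p\<in>P. if (p, q) = (w, y) then 1 else 0) = (if q = y then 1 else (0::real))" if "w \<in> P" for w
    using that \<open>finite P\<close> by (cases "q = y") (auto simp: if_distrib)
  then show ?case
    using Cons e by (simp add: sum.distrib sum_subtractf)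
qed auto

lemma reroute_cost:
  fixes z :: "'a::metric_space"
  assumes "finite P" "z \<in> P" "set l \<subseteq> P \<times> P"
  shows "(\<Sum>e\<in>P \<times> P. reroute z l e * dist (fst e) (snd e)) = path_cost r z l - dist (path_end z l) r"
  using assms(2,3)
proof (induction l arbitrary: z)
  case (Cons e l)
  obtain x y where e: "e = (x, y)" by (cases e)
  have *: "(\<Sum>e\<in>P \<times> P. (if e = (w, y) then 1 else 0) * dist (fst e) (snd e)) = dist w y" if "w \<in> P" for w
  proof -
    have "(\<Sum>e\<in>P \<times> P. (if e = (w, y) then 1 else 0) * dist (fst e) (snd e))
        = (\<Sum>e\<in>P \<times> P. if e = (w, y) then dist w y else 0)"
      by (intro sum.cong) auto
    then show ?thesis using that \<open>finite P\<close> e Cons.prems by simp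
  qed
  show ?case
    using Cons e by (simp add: sum.distrib sum_subtractf distrib_right left_diff_distrib *)
qed auto

text \<open>
  Mass is only removed from pairs in the list. The first bound allows for a pair that
  occurs in the list several times.
\<close>

lemma reroute_ge:
  "- real (length l) \<le> reroute z l e" "e \<notin> set l \<Longrightarrow> 0 \<le> reroute z l e"
proof -
  show "- real (length l) \<le> reroute z l e"
    by (induction z l e rule: reroute.induct) auto
  show "e \<notin> set l \<Longrightarrow> 0 \<le> reroute z l e"
    by (induction z l e rule: reroute.induct) auto
qed

text \<open>
  Requiring the weights to vanish outside \<open>P \<times> P\<close> makes the set compact in the product
  topology of the full function space.
\<close>

definition couplings :: "'a set \<Rightarrow> ('a \<Rightarrow> real) \<Rightarrow> ('a \<Rightarrow> real) \<Rightarrow> ('a \<times> 'a \<Rightarrow> real) set" where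
  "couplings P a b = {w. (\<forall>e. 0 \<le> w e) \<and> (\<forall>e. e \<notin> P \<times> P \<longrightarrow> w e = 0) \<and>
     (\<forall>p\<in>P. (\<Sum>q\<in>P. w (p, q)) = a p) \<and> (\<forall>q\<in>P. (\<Sum>p\<in>P. w (p, q)) = b q)}"

lemma compact_couplings:
  assumes "finite P"
  shows "compact (couplings P a b)"
proof -
  define C where "C = (\<Sum>p\<in>P. \<bar>a p\<bar>)"
  define B where "B = (\<Pi>\<^sub>E e\<in>UNIV. {0 .. (if e \<in> P \<times> P then C else 0)})"
  have "compactin (product_topology (\<lambda>_. euclidean) UNIV) B"
    unfolding B_def compactin_PiE by auto
  then have cB: "compact B"
    by (simp add: euclidean_product_topology)
  have cont: "continuous_on UNIV (\<lambda>w::'a\<times>'a\<Rightarrow>real. w e)" for e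
    by simp
  have closed: "closed (couplings P a b)"
    unfolding couplings_def Ball_def
    by (intro closed_Collect_conj closed_Collect_all closed_Collect_imp closed_Collect_le
        closed_Collect_eq continuous_on_const continuous_on_sum cont open_Collect_const)
  have "couplings P a b \<subseteq> B"
  proof
    fix w assume w: "w \<in> couplings P a b"
    have "w e \<le> C" if eP: "e \<in> P \<times> P" for e
    proof -
      obtain p q where e: "e = (p, q)" "p \<in> P" "q \<in> P" using eP by blast
      have "w (p, q) \<le> (\<Sum>q\<in>P. w (p, q))"
        using w e assms by (intro member_le_sum) (auto simp: couplings_def)
      also have "\<dots> = a p" using w e by (auto simp: couplings_def)
      also have "\<dots> \<le> \<bar>a p\<bar>" by simp
      also have "\<dots> \<le> C" unfolding C_def using e assms by (intro member_le_sum) auto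
      finally show ?thesis using e by simp
    qed
    then show "w \<in> B" using w by (auto simp: B_def couplings_def)
  qed
  then show ?thesis using closed cB
    by (metis compact_Int_closed inf.absorb_iff2 Int_commute)
qed

lemma couplings_nonempty:
  assumes "\<And>p. p \<in> P \<Longrightarrow> 0 \<le> a p" "\<And>p. p \<in> P \<Longrightarrow> 0 \<le> b p"
    and "(\<Sum>p\<in>P. a p) = 1" "(\<Sum>p\<in>P. b p) = 1"
  shows "couplings P a b \<noteq> {}"
proof -
  have "(\<lambda>e. if e \<in> P \<times> P then a (fst e) * b (snd e) else 0) \<in> couplings P a b"
    using assms by (auto simp: couplings_def simp flip: sum_distrib_left sum_distrib_right)
  then show ?thesis by blast
qed

text \<open>
  A cheapest coupling \<open>w\<close> exists by compactness. Rerouting a little mass along a closed path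
  through its support gives another coupling, so no such path has negative cost. Hence
  shortest path distances to a root are finite. As functions of the starting point
  they are 1-Lipschitz, and they drop by the full distance along every pair that \<open>w\<close> uses. They thus
  form a potential that certifies the optimality of \<open>w\<close>.
\<close>

lemma finite_kantorovich_duality:
  fixes P :: "'a::metric_space set"
  assumes fin: "finite P"
    and ab: "\<And>p. p \<in> P \<Longrightarrow> 0 \<le> a p" "\<And>p. p \<in> P \<Longrightarrow> 0 \<le> b p"
    and tot: "(\<Sum>p\<in>P. a p) = 1" "(\<Sum>p\<in>P. b p) = 1"
  obtains w u where "w \<in> couplings P a b" "1-lipschitz_on UNIV u"
    "(\<Sum>e\<in>P \<times> P. w e * dist (fst e) (snd e)) = (\<Sum>p\<in>P. u p * a p) - (\<Sum>p\<in>P. u p * b p)"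
proof -
  define cost where "cost w = (\<Sum>e\<in>P \<times> P. w e * dist (fst e) (snd e))" for w
  have "continuous_on (couplings P a b) cost"
    unfolding cost_def
    by (intro continuous_on_sum continuous_on_mult continuous_on_const)
       (metis continuous_on_product_coordinates continuous_on_subset top_greatest)
  from continuous_attains_inf[OF compact_couplings[OF fin] couplings_nonempty[OF ab tot] this]
  obtain w where w: "w \<in> couplings P a b" and wmin: "\<And>v. v \<in> couplings P a b \<Longrightarrow> cost w \<le> cost v"
    by auto
  define S where "S = {e \<in> P \<times> P. 0 < w e}"
  have finS: "finite S" using fin by (simp add: S_def)
  have cyc: "dist (path_end z l) r \<le> path_cost r z l"
    if l: "set l \<subseteq> S" and closed: "path_end z l = z" and z: "z \<in> P" for z l r
  proof (cases "l = []")
    case False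
    define m where "m = Min (w ` S)"
    have "S \<noteq> {}" using False l by (cases l) auto
    have m0: "0 < m" and mle: "\<And>e. e \<in> S \<Longrightarrow> m \<le> w e"
      unfolding m_def using finS \<open>S \<noteq> {}\<close> by (auto simp: S_def)
    \<comment> \<open>As a pair may occur \<open>length l\<close> times, at most this fraction of the least mass can be moved.\<close>
    define t where "t = m / length l"
    have t0: "0 < t" using m0 False by (simp add: t_def)
    define v where "v e = (if e \<in> P \<times> P then w e + t * reroute z l e else 0)" for e
    have lP: "set l \<subseteq> P \<times> P" using l by (auto simp: S_def)
    have v: "v \<in> couplings P a b"
    proof -
      have "0 \<le> v e" for e
      proof (cases "e \<in> set l")
        case True
        then have "m \<le> w e" using l mle by blast
        moreover have "t * reroute z l e \<ge> t * (- real (length l))"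
          using t0 by (intro mult_left_mono reroute_ge) auto
        moreover have "t * (- real (length l)) = - m" using False by (simp add: t_def)
        ultimately show ?thesis by (simp add: v_def)
      next
        case False
        then show ?thesis using w t0 reroute_ge(2)[OF False, of z]
          by (auto simp: v_def couplings_def)
      qed
      moreover have "(\<Sum>q\<in>P. v (p, q)) = a p" if "p \<in> P" for p
        using w that reroute_row_sum[OF fin z lP that] closed
        by (simp add: v_def couplings_def sum.distrib flip: sum_distrib_left)
      moreover have "(\<Sum>p\<in>P. v (p, q)) = b q" if "q \<in> P" for q
        using w that reroute_column_sum[OF fin z lP that]
        by (simp add: v_def couplings_def sum.distrib flip: sum_distrib_left)
      moreover have "v e = 0" if "e \<notin> P \<times> P" for e
        unfolding v_def using that by (rule if_not_P)
      ultimately show ?thesis unfolding couplings_def by blast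
    qed
    have "cost v = (\<Sum>e\<in>P \<times> P. w e * dist (fst e) (snd e) + t * (reroute z l e * dist (fst e) (snd e)))"
      unfolding cost_def v_def by (intro sum.cong) (auto simp: algebra_simps)
    also have "\<dots> = cost w + t * (path_cost r z l - dist (path_end z l) r)"
      using reroute_cost[OF fin z lP, of r]
      by (simp add: cost_def sum.distrib flip: sum_distrib_left)
    finally have "0 \<le> t * (path_cost r z l - dist (path_end z l) r)"
      using wmin[OF v] by simp
    then show ?thesis using t0 by (simp add: zero_le_mult_iff)
  qed simp
  have pc_lip: "path_cost r z l \<le> dist z z' + path_cost r z' l" for r z z' l
  proof (cases l)
    case (Cons e l')
    then show ?thesis using dist_triangle[of z "snd e" z'] by (cases e) simp
  qed (simp add: dist_triangle)
  have pc_end: "path_end z l = path_end z' l" if "l \<noteq> []" for z z' l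
    using that by (cases l) auto
  \<comment> \<open>Closing the path at its last point turns the bound for closed paths into one for all paths.\<close>
  have lower: "- dist z r \<le> path_cost r z l" if l: "set l \<subseteq> S" for z r l
  proof (cases "l = []")
    case False
    define z' where "z' = path_end z l"
    obtain x y l' where "l = (x, y) # l'"
      using False by (cases l) auto
    then have "z' \<in> P"
      using path_end_in[of x P l'] l by (auto simp: S_def z'_def)
    then have "dist z' r \<le> path_cost r z' l"
      using cyc[OF l _ \<open>z' \<in> P\<close>, of r] pc_end[OF False, of z' z] unfolding z'_def[symmetric] by simp
    also have "\<dots> \<le> dist z' z + path_cost r z l" by (rule pc_lip)
    finally show ?thesis
      using dist_triangle[of z z' r] dist_triangle[of z' r z] dist_triangle[of z' z r]
        dist_triangle[of z r z'] by (simp add: dist_commute)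
  qed simp
  obtain r where "r \<in> P" using tot(1) by fastforce
  define u where "u z = (INF l\<in>lists S. path_cost r z l)" for z
  have bdd: "bdd_below (path_cost r z ` lists S)" for z
    by (rule bdd_belowI2[of _ "- dist z r"]) (auto intro!: lower)
  have ne: "lists S \<noteq> {}" by auto
  have ulip: "u z \<le> dist z z' + u z'" for z z'
  proof -
    have "u z - dist z z' \<le> u z'"
      unfolding u_def[of z']
    proof (rule cINF_greatest[OF ne])
      fix l assume "l \<in> lists S"
      then have "u z \<le> path_cost r z l" unfolding u_def by (intro cINF_lower[OF bdd])
      then show "u z - dist z z' \<le> path_cost r z' l" using pc_lip[of r z l z'] by simp
    qed
    then show ?thesis by simp
  qed
  have lip: "1-lipschitz_on UNIV u"
  proof (rule lipschitz_onI)
    show "dist (u z) (u z') \<le> 1 * dist z z'" for z z'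
      using ulip[of z z'] ulip[of z' z] by (simp add: dist_real_def abs_le_iff dist_commute)
  qed simp
  have tight: "u x - u y = dist x y" if "(x, y) \<in> S" for x y
  proof -
    have "u y + dist x y \<le> u x"
      unfolding u_def[of x]
    proof (rule cINF_greatest[OF ne])
      fix l assume "l \<in> lists S"
      \<comment> \<open>A path from \<open>x\<close> becomes a path from \<open>y\<close> by first going back along the used pair \<open>(x, y)\<close>.\<close>
      then have "u y \<le> path_cost r y ((x, y) # l)"
        unfolding u_def using that by (intro cINF_lower[OF bdd]) auto
      then show "u y + dist x y \<le> path_cost r x l" by simp
    qed
    then show ?thesis using ulip[of x y] by simp
  qed
  have "cost w = (\<Sum>e\<in>P \<times> P. w e * (u (fst e) - u (snd e)))"
    unfolding cost_def
  proof (intro sum.cong refl)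
    fix e assume e: "e \<in> P \<times> P"
    show "w e * dist (fst e) (snd e) = w e * (u (fst e) - u (snd e))"
    proof (cases "0 < w e")
      case True then show ?thesis using e tight[of "fst e" "snd e"] by (auto simp: S_def)
    next
      case False
      moreover have "0 \<le> w e" using w unfolding couplings_def by blast
      ultimately show ?thesis by simp
    qed
  qed
  also have "\<dots> = (\<Sum>p\<in>P. \<Sum>q\<in>P. u p * w (p, q)) - (\<Sum>p\<in>P. \<Sum>q\<in>P. u q * w (p, q))"
    by (simp add: sum.cartesian_product sum_subtractf algebra_simps case_prod_unfold)
  also have "(\<Sum>p\<in>P. \<Sum>q\<in>P. u q * w (p, q)) = (\<Sum>q\<in>P. \<Sum>p\<in>P. u q * w (p, q))"
    by (rule sum.swap)
  finally have "cost w = (\<Sum>p\<in>P. u p * a p) - (\<Sum>p\<in>P. u p * b p)"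
    using w by (simp add: couplings_def flip: sum_distrib_left)
  then show ?thesis using that[OF w lip] by (simp add: cost_def)
qed

section \<open>Transport plans on compact sets\<close>

lemma prob_measures_onD:
  assumes "\<mu> \<in> prob_measures_on \<Omega>" "compact \<Omega>"
  shows "prob_space \<mu>" "sets \<mu> = sets borel" "space \<mu> = UNIV" "AE x in \<mu>. x \<in> \<Omega>" "\<Omega> \<noteq> {}"
proof -
  show p: "prob_space \<mu>" and s: "sets \<mu> = sets borel"
    using assms by (auto simp: prob_measures_on_def)
  show "space \<mu> = UNIV" using sets_eq_imp_space_eq[OF s] by simp
  interpret prob_space \<mu> by (rule p)
  have "emeasure \<mu> \<Omega> = 1" using assms by (auto simp: prob_measures_on_def)
  then have "prob \<Omega> = 1" by (simp add: measure_def)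
  then show "AE x in \<mu>. x \<in> \<Omega>" "\<Omega> \<noteq> {}"
    by (auto dest: AE_prob_1)
qed

lemma transport_planD:
  assumes \<gamma>: "\<gamma> \<in> transport_plans \<mu> \<nu>" and "prob_space \<mu>"
  shows "prob_space \<gamma>" "sets \<gamma> = sets borel" "fst \<in> \<gamma> \<rightarrow>\<^sub>M borel" "snd \<in> \<gamma> \<rightarrow>\<^sub>M borel"
proof -
  show s: "sets \<gamma> = sets borel" using \<gamma> by (simp add: transport_plans_def)
  show "fst \<in> \<gamma> \<rightarrow>\<^sub>M borel" "snd \<in> \<gamma> \<rightarrow>\<^sub>M borel"
    by (simp_all add: measurable_cong_sets[OF s refl] borel_measurable_continuous_onI
        continuous_on_fst continuous_on_snd)
  moreover have "prob_space (distr \<gamma> borel fst)"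
    using assms by (auto simp: transport_plans_def)
  ultimately show "prob_space \<gamma>"
    by (metis prob_space_distrD)
qed

lemma AE_transport_plan:
  assumes \<gamma>: "\<gamma> \<in> transport_plans \<mu> \<nu>" and "prob_space \<mu>"
  shows "AE x in \<mu>. Q x \<Longrightarrow> AE z in \<gamma>. Q (fst z)" "AE y in \<nu>. R y \<Longrightarrow> AE z in \<gamma>. R (snd z)"
  using \<gamma> AE_distrD[OF transport_planD(3)[OF assms], of Q] AE_distrD[OF transport_planD(4)[OF assms], of R]
  by (auto simp: transport_plans_def)

lemma integral_transport_plan:
  fixes f :: "'a::euclidean_space \<Rightarrow> real"
  assumes \<gamma>: "\<gamma> \<in> transport_plans \<mu> \<nu>" and "prob_space \<mu>" and f: "f \<in> borel_measurable borel"
  shows "(LINT z|\<gamma>. f (fst z)) = (LINT x|\<mu>. f x)" "(LINT z|\<gamma>. f (snd z)) = (LINT y|\<nu>. f y)"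
  using \<gamma> integral_distr[OF transport_planD(3)[OF assms(1,2)] f] integral_distr[OF transport_planD(4)[OF assms(1,2)] f]
  by (auto simp: transport_plans_def)

lemma integrable_bounded_on:
  fixes f :: "'a::topological_space \<Rightarrow> real"
  assumes "finite_measure M" "sets M = sets borel" "AE x in M. x \<in> K"
    and "f \<in> borel_measurable borel" "bounded (f ` K)"
  shows "integrable M f"
proof -
  interpret finite_measure M by fact
  obtain B where B: "\<And>x. x \<in> K \<Longrightarrow> norm (f x) \<le> B" using assms(5) by (auto simp: bounded_iff)
  show ?thesis
  proof (rule integrable_const_bound)
    show "AE x in M. norm (f x) \<le> B" using assms(3) by eventually_elim (rule B)
    show "f \<in> borel_measurable M" using assms(4) by (simp add: measurable_cong_sets[OF assms(2) refl])
  qed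
qed

section \<open>Kantorovich duality on compact sets\<close>

lemma integral_of_simple_function:
  fixes g :: "'b \<Rightarrow> real"
  assumes "finite_measure M" and r: "simple_function M r" and "finite P" "r ` space M \<subseteq> P"
  shows "integrable M (\<lambda>x. g (r x))"
    and "(LINT x|M. g (r x)) = (\<Sum>p\<in>P. g p * measure M (r -` {p} \<inter> space M))"
proof -
  interpret finite_measure M by fact
  have cell: "r -` {p} \<inter> space M \<in> sets M" for p
    using simple_functionD(2)[OF r, of "{p}"] .
  have eq: "g (r x) = (\<Sum>p\<in>P. g p * indicator (r -` {p} \<inter> space M) x)" if x: "x \<in> space M" for x
  proof -
    have "(\<Sum>p\<in>P. g p * indicator (r -` {p} \<inter> space M) x) = (\<Sum>p\<in>P. if p = r x then g p else 0)"
      using x by (intro sum.cong) (auto simp: indicator_def)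
    then show ?thesis using assms(3,4) x by auto
  qed
  have int: "integrable M (\<lambda>x. g p * indicator (r -` {p} \<inter> space M) x)" for p
    using cell by (auto simp: emeasure_eq_measure)
  show "integrable M (\<lambda>x. g (r x))"
    using int by (subst Bochner_Integration.integrable_cong[OF refl eq]) auto
  have "(LINT x|M. g (r x)) = (LINT x|M. (\<Sum>p\<in>P. g p * indicator (r -` {p} \<inter> space M) x))"
    by (rule Bochner_Integration.integral_cong[OF refl eq])
  also have "\<dots> = (\<Sum>p\<in>P. LINT x|M. g p * indicator (r -` {p} \<inter> space M) x)"
    using int by (intro Bochner_Integration.integral_sum) auto
  also have "\<dots> = (\<Sum>p\<in>P. g p * measure M (r -` {p} \<inter> space M))"
    using cell by (intro sum.cong) auto
  finally show "(LINT x|M. g (r x)) = (\<Sum>p\<in>P. g p * measure M (r -` {p} \<inter> space M))" .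
qed

text \<open>
  Rounding to a finite set, with an error that is small on average for both measures.
\<close>

lemma simple_approximation_of_identity:
  fixes \<mu> \<nu> :: "'a::euclidean_space measure"
  assumes \<Omega>: "compact \<Omega>" and \<mu>: "\<mu> \<in> prob_measures_on \<Omega>" and \<nu>: "\<nu> \<in> prob_measures_on \<Omega>" and "0 < e"
  obtains r :: "'a \<Rightarrow> 'a" where "simple_function borel r"
    "(LINT x|\<mu>. dist x (r x)) < e" "(LINT x|\<nu>. dist x (r x)) < e"
proof -
  obtain F :: "nat \<Rightarrow> 'a \<Rightarrow> 'a" where F: "\<And>i. simple_function borel (F i)" "\<And>x. (\<lambda>i. F i x) \<longlonglongrightarrow> x"
    and bound: "\<And>i x. dist (F i x) 0 \<le> 2 * dist x 0"
    using borel_measurable_implies_sequence_metric[of "\<lambda>x::'a. x" borel 0] by auto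
  have lim: "(\<lambda>i. LINT x|m. dist x (F i x)) \<longlonglongrightarrow> 0" if m: "m \<in> prob_measures_on \<Omega>" for m
  proof -
    note mD = prob_measures_onD[OF m \<Omega>]
    interpret prob_space m by (rule mD)
    note [measurable_cong] = mD(2)
    have [measurable]: "F i \<in> borel_measurable borel" for i
      using F(1) by (rule borel_measurable_simple_function)
    have "integrable m (\<lambda>x. 3 * norm x)"
      by (rule integrable_bounded_on[OF finite_measure_axioms mD(2,4)])
         (auto intro!: compact_imp_bounded compact_continuous_image \<Omega> continuous_intros)
    then have "(\<lambda>i. LINT x|m. dist x (F i x)) \<longlonglongrightarrow> (LINT x|m. 0)"
    proof (rule integral_dominated_convergence[rotated 2])
      show "AE x in m. (\<lambda>i. dist x (F i x)) \<longlonglongrightarrow> 0"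
      proof (rule AE_I2)
        fix x show "(\<lambda>i. dist x (F i x)) \<longlonglongrightarrow> 0"
          using tendsto_dist[OF tendsto_const F(2), of x x] by simp
      qed
      show "AE x in m. norm (dist x (F i x)) \<le> 3 * norm x" for i
      proof (rule AE_I2)
        fix x show "norm (dist x (F i x)) \<le> 3 * norm x"
          using bound[of i x] norm_triangle_ineq4[of x "F i x"] by (simp add: dist_norm)
      qed
    qed measurable
    then show ?thesis by simp
  qed
  have "eventually (\<lambda>i. (LINT x|\<mu>. dist x (F i x)) < e \<and> (LINT x|\<nu>. dist x (F i x)) < e) sequentially"
    using order_tendstoD(2)[OF lim[OF \<mu>] \<open>0 < e\<close>] order_tendstoD(2)[OF lim[OF \<nu>] \<open>0 < e\<close>]
    by (rule eventually_conj)
  then obtain i where "(LINT x|\<mu>. dist x (F i x)) < e \<and> (LINT x|\<nu>. dist x (F i x)) < e"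
    using eventually_happens by force
  then show ?thesis using that[of "F i"] F(1) by blast
qed

lemma lipschitz_1_borel_measurable:
  fixes u :: "'a::euclidean_space \<Rightarrow> real"
  assumes "1-lipschitz_on UNIV u"
  shows "u \<in> borel_measurable borel"
  using lipschitz_on_continuous_on[OF assms] by (rule borel_measurable_continuous_onI)

lemma lipschitz_1_diff_le:
  fixes u :: "'a::metric_space \<Rightarrow> real"
  assumes "1-lipschitz_on UNIV u"
  shows "u x - u y \<le> dist x y"
  using lipschitz_onD[OF assms, of x y] by (auto simp: dist_real_def)

lemma integrable_lipschitz_1:
  fixes u :: "'a::euclidean_space \<Rightarrow> real"
  assumes "1-lipschitz_on UNIV u" "m \<in> prob_measures_on \<Omega>" "compact \<Omega>"
  shows "integrable m u"
proof -
  note mD = prob_measures_onD[OF assms(2,3)]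
  interpret prob_space m by (rule mD)
  show ?thesis
    by (rule integrable_bounded_on[OF finite_measure_axioms mD(2,4) lipschitz_1_borel_measurable[OF assms(1)]])
       (intro compact_imp_bounded compact_continuous_image assms(3)
         continuous_on_subset[OF lipschitz_on_continuous_on[OF assms(1)]] subset_UNIV)
qed

text \<open>
  Plans are built as densities with respect to the product measure. The marginals are correct as soon as
  the density integrates to one over almost every section.
\<close>

lemma marginals_of_density:
  fixes \<mu> \<nu> :: "'a::euclidean_space measure"
  assumes "prob_space \<mu>" "prob_space \<nu>" and sets: "sets \<mu> = sets borel" "sets \<nu> = sets borel"
    and h: "h \<in> borel_measurable (\<mu> \<Otimes>\<^sub>M \<nu>)"
  shows "AE x in \<mu>. (\<integral>\<^sup>+ y. h (x, y) \<partial>\<nu>) = 1 \<Longrightarrow> distr (density (\<mu> \<Otimes>\<^sub>M \<nu>) h) borel fst = \<mu>"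
    and "AE y in \<nu>. (\<integral>\<^sup>+ x. h (x, y) \<partial>\<mu>) = 1 \<Longrightarrow> distr (density (\<mu> \<Otimes>\<^sub>M \<nu>) h) borel snd = \<nu>"
proof -
  interpret M: prob_space \<mu> by fact
  interpret N: prob_space \<nu> by fact
  interpret MN: pair_prob_space \<mu> \<nu> ..
  note [measurable] = h
  note [measurable_cong] = sets
  let ?\<gamma> = "density (\<mu> \<Otimes>\<^sub>M \<nu>) h"
  have density: "emeasure (distr ?\<gamma> borel f) A = (\<integral>\<^sup>+ z. h z * indicator A (f z) \<partial>(\<mu> \<Otimes>\<^sub>M \<nu>))"
    if f[measurable]: "f \<in> (\<mu> \<Otimes>\<^sub>M \<nu>) \<rightarrow>\<^sub>M borel" and A[measurable]: "A \<in> sets borel"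
    for f :: "'a \<times> 'a \<Rightarrow> 'a" and A
  proof -
    have "emeasure (distr ?\<gamma> borel f) A = (\<integral>\<^sup>+ y. indicator A y \<partial>distr ?\<gamma> borel f)" by simp
    also have "\<dots> = (\<integral>\<^sup>+ z. indicator A (f z) \<partial>?\<gamma>)" by (intro nn_integral_distr) auto
    also have "\<dots> = (\<integral>\<^sup>+ z. h z * indicator A (f z) \<partial>(\<mu> \<Otimes>\<^sub>M \<nu>))" by (intro nn_integral_density) auto
    finally show ?thesis .
  qed
  show "distr ?\<gamma> borel fst = \<mu>" if 1: "AE x in \<mu>. (\<integral>\<^sup>+ y. h (x, y) \<partial>\<nu>) = 1"
  proof (rule measure_eqI)
    fix A assume "A \<in> sets (distr ?\<gamma> borel fst)"
    then have A[measurable]: "A \<in> sets borel" by simp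
    have "emeasure (distr ?\<gamma> borel fst) A = (\<integral>\<^sup>+ x. \<integral>\<^sup>+ y. h (x, y) * indicator A x \<partial>\<nu> \<partial>\<mu>)"
      by (subst density) (simp_all add: N.nn_integral_fst[symmetric])
    also have "\<dots> = (\<integral>\<^sup>+ x. (\<integral>\<^sup>+ y. h (x, y) \<partial>\<nu>) * indicator A x \<partial>\<mu>)"
      by (intro nn_integral_cong nn_integral_multc) simp
    also have "\<dots> = (\<integral>\<^sup>+ x. indicator A x \<partial>\<mu>)"
      using 1 by (intro nn_integral_cong_AE) auto
    finally show "emeasure (distr ?\<gamma> borel fst) A = emeasure \<mu> A" by simp
  qed (simp add: sets)
  show "distr ?\<gamma> borel snd = \<nu>" if 1: "AE y in \<nu>. (\<integral>\<^sup>+ x. h (x, y) \<partial>\<mu>) = 1"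
  proof (rule measure_eqI)
    fix A assume "A \<in> sets (distr ?\<gamma> borel snd)"
    then have A[measurable]: "A \<in> sets borel" by simp
    have "emeasure (distr ?\<gamma> borel snd) A = (\<integral>\<^sup>+ y. \<integral>\<^sup>+ x. h (x, y) * indicator A y \<partial>\<mu> \<partial>\<nu>)"
      by (subst density) (simp_all add: MN.nn_integral_snd[symmetric])
    also have "\<dots> = (\<integral>\<^sup>+ y. (\<integral>\<^sup>+ x. h (x, y) \<partial>\<mu>) * indicator A y \<partial>\<nu>)"
      by (intro nn_integral_cong nn_integral_multc) simp
    also have "\<dots> = (\<integral>\<^sup>+ y. indicator A y \<partial>\<nu>)"
      using 1 by (intro nn_integral_cong_AE) auto
    finally show "emeasure (distr ?\<gamma> borel snd) A = emeasure \<nu> A" by simp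
  qed (simp add: sets)
qed

text \<open>
  Let \<open>r\<close> round points to a finite set. The finite duality applies to the images of \<open>\<mu>\<close> and \<open>\<nu>\<close> under \<open>r\<close>.
  Its coupling lifts to a plan by spreading the mass of each pair \<open>(p, q)\<close> over the product of the
  cells \<open>r = p\<close> and \<open>r = q\<close> proportionally to \<open>\<mu> \<times> \<nu>\<close>. The
  potential is already defined on the whole space. Rounding changes the cost and the dual value by at most
  the average rounding errors.
\<close>

lemma kantorovich_duality_approx:
  fixes \<mu> \<nu> :: "'a::euclidean_space measure"
  assumes \<Omega>: "compact \<Omega>" and \<mu>: "\<mu> \<in> prob_measures_on \<Omega>" and \<nu>: "\<nu> \<in> prob_measures_on \<Omega>" and "0 < e"
  obtains \<gamma> u where "\<gamma> \<in> transport_plans \<mu> \<nu>" "1-lipschitz_on UNIV u"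
    "(LINT z|\<gamma>. dist (fst z) (snd z)) \<le> (LINT x|\<mu>. u x) - (LINT y|\<nu>. u y) + e"
proof -
  note \<mu>D = prob_measures_onD[OF \<mu> \<Omega>]
  note \<nu>D = prob_measures_onD[OF \<nu> \<Omega>]
  interpret M: prob_space \<mu> by (rule \<mu>D)
  interpret N: prob_space \<nu> by (rule \<nu>D)
  note [measurable_cong] = \<mu>D(2) \<nu>D(2)
  obtain r :: "'a \<Rightarrow> 'a" where r: "simple_function borel r"
    and e: "(LINT x|\<mu>. dist x (r x)) < e / 4" "(LINT x|\<nu>. dist x (r x)) < e / 4"
    using simple_approximation_of_identity[OF \<Omega> \<mu> \<nu>, of "e / 4"] \<open>0 < e\<close> by auto
  define P where "P = range r"
  have fin: "finite P" using r by (simp add: P_def simple_function_def)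
  have rP: "r x \<in> P" for x by (simp add: P_def)
  have rm[measurable]: "r \<in> borel_measurable borel"
    using r by (rule borel_measurable_simple_function)
  have cell[measurable]: "r -` {p} \<in> sets borel" for p
    using measurable_sets[of r borel borel "{p}"] by simp
  have r\<mu>: "simple_function \<mu> r" and r\<nu>: "simple_function \<nu> r"
    using r simple_function_cong_algebra[of \<mu> borel] simple_function_cong_algebra[of \<nu> borel]
    by (auto simp: \<mu>D \<nu>D)
  define a where "a p = measure \<mu> (r -` {p})" for p
  define b where "b p = measure \<nu> (r -` {p})" for p
  have int\<mu>: "integrable \<mu> (\<lambda>x. g (r x))" "(LINT x|\<mu>. g (r x)) = (\<Sum>p\<in>P. g p * a p)" for g :: "'a \<Rightarrow> real"
    using integral_of_simple_function[OF M.finite_measure_axioms r\<mu> fin, where g = g] rP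
    by (auto simp: \<mu>D a_def)
  have int\<nu>: "integrable \<nu> (\<lambda>x. g (r x))" "(LINT x|\<nu>. g (r x)) = (\<Sum>p\<in>P. g p * b p)" for g :: "'a \<Rightarrow> real"
    using integral_of_simple_function[OF N.finite_measure_axioms r\<nu> fin, where g = g] rP
    by (auto simp: \<nu>D b_def)
  obtain w u where w: "w \<in> couplings P a b" and u: "1-lipschitz_on UNIV u"
    and wu: "(\<Sum>e\<in>P \<times> P. w e * dist (fst e) (snd e)) = (\<Sum>p\<in>P. u p * a p) - (\<Sum>p\<in>P. u p * b p)"
  proof (rule finite_kantorovich_duality[OF fin, of a b])
    show "sum a P = 1" "sum b P = 1"
      using int\<mu>(2)[of "\<lambda>_. 1"] int\<nu>(2)[of "\<lambda>_. 1"] by (simp_all add: M.prob_space N.prob_space)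
  qed (auto simp: a_def b_def)
  have w0: "0 \<le> w e" for e
    using w unfolding couplings_def by blast
  have row: "p \<in> P \<Longrightarrow> (\<Sum>q\<in>P. w (p, q)) = a p" and col: "q \<in> P \<Longrightarrow> (\<Sum>p\<in>P. w (p, q)) = b q" for p q
    using w unfolding couplings_def by blast+
  have w_row0: "w (p, q) = 0" if "a p = 0" "p \<in> P" "q \<in> P" for p q
    using row[OF that(2)] that fin w0 by (simp add: sum_nonneg_eq_0_iff)
  have w_col0: "w (p, q) = 0" if "b q = 0" "p \<in> P" "q \<in> P" for p q
    using col[OF that(3)] that fin w0 by (simp add: sum_nonneg_eq_0_iff)
  \<comment> \<open>A null cell makes the denominator zero, but the coupling gives such a cell no mass either.\<close>
  define k where "k p q = w (p, q) / (a p * b q)" for p q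
  have k0: "0 \<le> k p q" for p q using w0 by (simp add: k_def a_def b_def)
  have kab: "k p q * (a p * b q) = w (p, q)" if "p \<in> P" "q \<in> P" for p q
    using w_row0 w_col0 that by (auto simp: k_def)
  define R where "R z = (r (fst z), r (snd z))" for z
  have R: "simple_function (borel \<Otimes>\<^sub>M borel) R"
    unfolding R_def by (intro simple_function_Pair simple_function_comp[OF _ r]) auto
  define h where "h z = ennreal (case_prod k (R z))" for z
  have [measurable]: "h \<in> borel_measurable (borel \<Otimes>\<^sub>M borel)"
    unfolding h_def by (intro borel_measurable_simple_function simple_function_compose1[OF R])
  define \<gamma> where "\<gamma> = density (\<mu> \<Otimes>\<^sub>M \<nu>) h"
  have sets\<gamma>: "sets \<gamma> = sets borel"
    unfolding \<gamma>_def sets_density sets_pair_measure_cong[OF \<mu>D(2) \<nu>D(2)] by (simp only: borel_prod)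
  have nonnull: "AE x in m. measure m (r -` {r x}) \<noteq> 0"
    if "prob_space m" and sets: "sets m = sets borel" for m
  proof -
    interpret m: prob_space m by fact
    have "AE x in m. x \<notin> r -` {p}" if "measure m (r -` {p}) = 0" for p
      using that cell[of p] by (intro AE_not_in null_setsI) (auto simp: m.emeasure_eq_measure sets)
    then have "AE x in m. \<forall>p\<in>P. measure m (r -` {p}) = 0 \<longrightarrow> x \<notin> r -` {p}"
      by (intro AE_finite_allI fin AE_impI)
    then show ?thesis by eventually_elim (use rP in auto)
  qed
  have fst_eq: "distr \<gamma> borel fst = \<mu>"
    unfolding \<gamma>_def
  proof (rule marginals_of_density(1))
    show "AE x in \<mu>. (\<integral>\<^sup>+ y. h (x, y) \<partial>\<nu>) = 1"
      using nonnull[OF M.prob_space_axioms \<mu>D(2)]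
    proof eventually_elim
      case (elim x)
      then have ax: "a (r x) \<noteq> 0" by (simp add: a_def)
      have "(\<integral>\<^sup>+ y. h (x, y) \<partial>\<nu>) = ennreal (LINT y|\<nu>. k (r x) (r y))"
        unfolding h_def R_def using k0 by (auto intro!: nn_integral_eq_integral int\<nu>)
      also have "(LINT y|\<nu>. k (r x) (r y)) = (\<Sum>q\<in>P. w (r x, q) / a (r x))"
        unfolding int\<nu> using ax w_col0 rP by (intro sum.cong) (auto simp: k_def)
      also have "\<dots> = 1" using row[OF rP, of x] ax by (simp flip: sum_divide_distrib)
      finally show ?case by simp
    qed
  qed (auto simp: \<mu>D \<nu>D)
  have snd_eq: "distr \<gamma> borel snd = \<nu>"
    unfolding \<gamma>_def
  proof (rule marginals_of_density(2))
    show "AE y in \<nu>. (\<integral>\<^sup>+ x. h (x, y) \<partial>\<mu>) = 1"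
      using nonnull[OF N.prob_space_axioms \<nu>D(2)]
    proof eventually_elim
      case (elim y)
      then have ay: "b (r y) \<noteq> 0" by (simp add: b_def)
      have "(\<integral>\<^sup>+ x. h (x, y) \<partial>\<mu>) = ennreal (LINT x|\<mu>. k (r x) (r y))"
        unfolding h_def R_def using k0 int\<mu>(1)[of "\<lambda>p. k p (r y)"] by (auto intro!: nn_integral_eq_integral)
      also have "(LINT x|\<mu>. k (r x) (r y)) = (\<Sum>p\<in>P. w (p, r y) / b (r y))"
        unfolding int\<mu>(2)[of "\<lambda>p. k p (r y)"] using ay w_row0 rP by (intro sum.cong) (auto simp: k_def)
      also have "\<dots> = 1" using col[OF rP, of y] ay by (simp flip: sum_divide_distrib)
      finally show ?case by simp
    qed
  qed (auto simp: \<mu>D \<nu>D)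
  have \<gamma>: "\<gamma> \<in> transport_plans \<mu> \<nu>"
    using sets\<gamma> fst_eq snd_eq by (simp add: transport_plans_def)
  note \<gamma>D = transport_planD[OF \<gamma> M.prob_space_axioms]
  interpret G: prob_space \<gamma> by (rule \<gamma>D)
  have space\<gamma>: "space \<gamma> = UNIV" using sets_eq_imp_space_eq[OF sets\<gamma>] by simp
  have R\<gamma>: "simple_function \<gamma> R"
    using R simple_function_cong_algebra[of "borel" \<gamma> R] by (simp add: sets\<gamma> borel_prod space\<gamma>)
  have mass: "measure \<gamma> (R -` {(p, q)}) = w (p, q)" if "p \<in> P" "q \<in> P" for p q
  proof -
    have eq: "R -` {(p, q)} = r -` {p} \<times> r -` {q}" by (auto simp: R_def)
    have "emeasure \<gamma> (R -` {(p, q)}) = (\<integral>\<^sup>+ z. h z * indicator (r -` {p} \<times> r -` {q}) z \<partial>(\<mu> \<Otimes>\<^sub>M \<nu>))"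
      unfolding eq \<gamma>_def by (rule emeasure_density) auto
    also have "\<dots> = (\<integral>\<^sup>+ z. ennreal (k p q) * indicator (r -` {p} \<times> r -` {q}) z \<partial>(\<mu> \<Otimes>\<^sub>M \<nu>))"
      by (intro nn_integral_cong) (auto simp: h_def R_def indicator_def)
    also have "\<dots> = ennreal (k p q) * emeasure (\<mu> \<Otimes>\<^sub>M \<nu>) (r -` {p} \<times> r -` {q})"
      by (intro nn_integral_cmult_indicator) auto
    also have "emeasure (\<mu> \<Otimes>\<^sub>M \<nu>) (r -` {p} \<times> r -` {q}) = ennreal (a p * b q)"
      by (subst N.emeasure_pair_measure_Times)
         (auto simp: a_def b_def M.emeasure_eq_measure N.emeasure_eq_measure ennreal_mult)
    also have "ennreal (k p q) * ennreal (a p * b q) = ennreal (w (p, q))"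
      using kab[OF that] k0 by (simp add: a_def b_def flip: ennreal_mult)
    finally show ?thesis using w0 by (simp add: measure_def)
  qed
  have cost_int: "integrable \<gamma> (\<lambda>z. dist (fst (R z)) (snd (R z)))"
    and cost: "(LINT z|\<gamma>. dist (fst (R z)) (snd (R z))) = (\<Sum>e\<in>P \<times> P. w e * dist (fst e) (snd e))"
  proof -
    have *: "R ` space \<gamma> \<subseteq> P \<times> P" using rP by (auto simp: R_def)
    note S = integral_of_simple_function[OF G.finite_measure_axioms R\<gamma> finite_cartesian_product[OF fin fin] *,
        where g = "\<lambda>e. dist (fst e) (snd e)"]
    show "integrable \<gamma> (\<lambda>z. dist (fst (R z)) (snd (R z)))" by (rule S)
    show "(LINT z|\<gamma>. dist (fst (R z)) (snd (R z))) = (\<Sum>e\<in>P \<times> P. w e * dist (fst e) (snd e))"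
      unfolding S(2) by (intro sum.cong refl) (auto simp: space\<gamma> mass)
  qed
  define \<delta> where "\<delta> x = dist x (r x)" for x
  have [measurable]: "\<delta> \<in> borel_measurable borel" unfolding \<delta>_def by measurable
  have \<delta>: "integrable m \<delta>" if m: "m \<in> prob_measures_on \<Omega>" for m
  proof -
    note mD = prob_measures_onD[OF m \<Omega>]
    interpret m: prob_space m by (rule mD)
    obtain B where B: "\<And>x. x \<in> \<Omega> \<Longrightarrow> norm x \<le> B" using compact_imp_bounded[OF \<Omega>] by (auto simp: bounded_iff)
    have "norm (r x) \<le> Max (norm ` P)" for x
      using fin rP by (intro Max_ge) auto
    then have "norm (\<delta> x) \<le> B + Max (norm ` P)" if "x \<in> \<Omega>" for x
      using B[OF that] norm_triangle_ineq4[of x "r x"]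
      by (simp add: \<delta>_def dist_norm) (meson add_mono order_trans)
    then have "bounded (\<delta> ` \<Omega>)" by (auto simp: bounded_iff)
    then show ?thesis
      by (intro integrable_bounded_on[OF m.finite_measure_axioms mD(2,4)]) auto
  qed
  have \<delta>\<gamma>: "integrable \<gamma> (\<lambda>z. \<delta> (fst z))" "integrable \<gamma> (\<lambda>z. \<delta> (snd z))"
    using \<delta>[OF \<mu>] \<delta>[OF \<nu>] integrable_distr[OF \<gamma>D(3), of \<delta>] integrable_distr[OF \<gamma>D(4), of \<delta>]
    by (auto simp: fst_eq snd_eq)
  have "(LINT z|\<gamma>. dist (fst z) (snd z))
      \<le> (LINT z|\<gamma>. \<delta> (fst z) + dist (fst (R z)) (snd (R z)) + \<delta> (snd z))"
  proof (rule integral_mono')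
    fix z show "dist (fst z) (snd z) \<le> \<delta> (fst z) + dist (fst (R z)) (snd (R z)) + \<delta> (snd z)"
      using dist_triangle[of "fst z" "snd z" "r (fst z)"] dist_triangle[of "r (fst z)" "snd z" "r (snd z)"]
      by (simp add: \<delta>_def R_def dist_commute)
  qed (use \<delta>\<gamma> cost_int in \<open>auto simp: \<delta>_def\<close>)
  also have "\<dots> = (LINT x|\<mu>. \<delta> x) + (LINT z|\<gamma>. dist (fst (R z)) (snd (R z))) + (LINT x|\<nu>. \<delta> x)"
    using \<delta>\<gamma> cost_int integral_transport_plan[OF \<gamma> M.prob_space_axioms, of \<delta>] by simp
  also have "\<dots> \<le> e / 2 + ((\<Sum>p\<in>P. u p * a p) - (\<Sum>p\<in>P. u p * b p))"
    using e unfolding cost wu \<delta>_def by simp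
  finally have 1: "(LINT z|\<gamma>. dist (fst z) (snd z)) \<le> e / 2 + ((\<Sum>p\<in>P. u p * a p) - (\<Sum>p\<in>P. u p * b p))" .
  note e\<delta> = e[folded \<delta>_def]
  have ur: "u (r x) \<le> u x + \<delta> x" "u x \<le> u (r x) + \<delta> x" for x
    using lipschitz_1_diff_le[OF u, of "r x" x] lipschitz_1_diff_le[OF u, of x "r x"]
    by (simp_all add: \<delta>_def dist_commute)
  note iu = integrable_lipschitz_1[OF u \<mu> \<Omega>] integrable_lipschitz_1[OF u \<nu> \<Omega>]
  have "(\<Sum>p\<in>P. u p * a p) = (LINT x|\<mu>. u (r x))" by (rule int\<mu>(2)[symmetric])
  also have "\<dots> \<le> (LINT x|\<mu>. u x + \<delta> x)"
    using iu \<delta>[OF \<mu>] int\<mu>(1)[of u] by (intro integral_mono ur(1)) auto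
  also have "\<dots> \<le> (LINT x|\<mu>. u x) + e / 4"
    using e\<delta> iu \<delta>[OF \<mu>] by simp
  finally have 2: "(\<Sum>p\<in>P. u p * a p) \<le> (LINT x|\<mu>. u x) + e / 4" .
  have "(LINT x|\<nu>. u x) \<le> (LINT x|\<nu>. u (r x) + \<delta> x)"
    using iu \<delta>[OF \<nu>] int\<nu>(1)[of u] by (intro integral_mono ur(2)) auto
  also have "\<dots> \<le> (\<Sum>p\<in>P. u p * b p) + e / 4"
    using e\<delta> int\<nu>(1)[of u] \<delta>[OF \<nu>] by (simp add: int\<nu>(2))
  finally have 3: "(LINT x|\<nu>. u x) \<le> (\<Sum>p\<in>P. u p * b p) + e / 4" .
  show ?thesis using that[OF \<gamma> u] 1 2 3 by simp
qed

section \<open>Plans, maps and Wasserstein distances\<close>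

lemma AE_in_plan:
  assumes "compact \<Omega>" "\<mu> \<in> prob_measures_on \<Omega>" "\<nu> \<in> prob_measures_on \<Omega>" "\<gamma> \<in> transport_plans \<mu> \<nu>"
  shows "AE z in \<gamma>. z \<in> \<Omega> \<times> \<Omega>"
proof -
  note \<mu>D = prob_measures_onD[OF assms(2,1)] and \<nu>D = prob_measures_onD[OF assms(3,1)]
  show ?thesis
    using AE_transport_plan(1)[OF assms(4) \<mu>D(1,4)] AE_transport_plan(2)[OF assms(4) \<mu>D(1) \<nu>D(4)]
    by eventually_elim (auto simp: mem_Times_iff)
qed

lemma integrable_continuous_plan:
  fixes c :: "'a::euclidean_space \<times> 'a \<Rightarrow> real"
  assumes "compact \<Omega>" "\<mu> \<in> prob_measures_on \<Omega>" "\<nu> \<in> prob_measures_on \<Omega>" "\<gamma> \<in> transport_plans \<mu> \<nu>"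
    and "continuous_on UNIV c"
  shows "integrable \<gamma> c"
proof -
  note \<gamma>D = transport_planD[OF assms(4) prob_measures_onD(1)[OF assms(2,1)]]
  interpret prob_space \<gamma> by (rule \<gamma>D)
  show ?thesis
  proof (rule integrable_bounded_on[OF finite_measure_axioms \<gamma>D(2) AE_in_plan[OF assms(1-4)]])
    show "c \<in> borel_measurable borel" using assms(5) by (rule borel_measurable_continuous_onI)
    show "bounded (c ` (\<Omega> \<times> \<Omega>))"
      by (intro compact_imp_bounded compact_continuous_image compact_Times assms(1)
          continuous_on_subset[OF assms(5)] subset_UNIV)
  qed
qed

lemma continuous_dist_pair: "continuous_on UNIV (\<lambda>z::'a::metric_space \<times> 'a. dist (fst z) (snd z))"
  by (intro continuous_intros)

lemma weak_duality:
  fixes \<mu> \<nu> :: "'a::euclidean_space measure"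
  assumes "compact \<Omega>" "\<mu> \<in> prob_measures_on \<Omega>" "\<nu> \<in> prob_measures_on \<Omega>" "\<gamma> \<in> transport_plans \<mu> \<nu>"
    and u: "1-lipschitz_on UNIV u"
  shows "(LINT x|\<mu>. u x) - (LINT y|\<nu>. u y) \<le> (LINT z|\<gamma>. dist (fst z) (snd z))"
proof -
  note \<mu>D = prob_measures_onD[OF assms(2,1)]
  have cu: "continuous_on UNIV u" using u by (rule lipschitz_on_continuous_on)
  have int: "integrable \<gamma> (\<lambda>z. u (fst z))" "integrable \<gamma> (\<lambda>z. u (snd z))"
    by (intro integrable_continuous_plan[OF assms(1-4)] continuous_on_compose2[OF cu] continuous_intros; simp)+
  have "(LINT x|\<mu>. u x) - (LINT y|\<nu>. u y) = (LINT z|\<gamma>. u (fst z) - u (snd z))"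
    using int integral_transport_plan[OF assms(4) \<mu>D(1) lipschitz_1_borel_measurable[OF u]] by simp
  also have "\<dots> \<le> (LINT z|\<gamma>. dist (fst z) (snd z))"
    using int lipschitz_1_diff_le[OF u]
    by (intro integral_mono integrable_continuous_plan[OF assms(1-4) continuous_dist_pair]) auto
  finally show ?thesis .
qed

lemma plan_of_maps:
  fixes S1 S2 :: "'a::euclidean_space \<Rightarrow> 'a"
  assumes sets: "sets \<mu> = sets borel" and S: "S1 \<in> borel_measurable borel" "S2 \<in> borel_measurable borel"
  shows "distr \<mu> borel (\<lambda>x. (S1 x, S2 x)) \<in> transport_plans (distr \<mu> borel S1) (distr \<mu> borel S2)"
    and "c \<in> borel_measurable borel \<Longrightarrow>
      (LINT z|distr \<mu> borel (\<lambda>x. (S1 x, S2 x)). c z) = (LINT x|\<mu>. c (S1 x, S2 x) :: real)"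
proof -
  note [measurable] = S and [measurable_cong] = sets
  have f[measurable]: "fst \<in> borel_measurable borel" "snd \<in> borel_measurable (borel :: ('a \<times> 'a) measure)"
    by (simp_all add: borel_measurable_continuous_onI continuous_on_fst continuous_on_snd)
  have p: "(\<lambda>x. (S1 x, S2 x)) \<in> borel_measurable \<mu>" by measurable
  show "distr \<mu> borel (\<lambda>x. (S1 x, S2 x)) \<in> transport_plans (distr \<mu> borel S1) (distr \<mu> borel S2)"
    using distr_distr[OF f(1) p] distr_distr[OF f(2) p]
    by (simp add: transport_plans_def comp_def)
  show "c \<in> borel_measurable borel \<Longrightarrow>
      (LINT z|distr \<mu> borel (\<lambda>x. (S1 x, S2 x)). c z) = (LINT x|\<mu>. c (S1 x, S2 x))"
    by (rule integral_distr[OF p])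
qed

lemma transport_plans_nonempty:
  assumes "compact \<Omega>" "\<mu> \<in> prob_measures_on \<Omega>" "\<nu> \<in> prob_measures_on \<Omega>"
  shows "transport_plans \<mu> \<nu> \<noteq> {}"
  using kantorovich_duality_approx[OF assms, of 1] by fastforce

lemma bdd_below_cost:
  assumes "\<And>z. 0 \<le> c z"
  shows "bdd_below ((\<lambda>\<gamma>. LINT z|\<gamma>. c z :: real) ` X)"
  by (rule bdd_belowI2[of _ 0]) (simp add: assms)

lemma wasserstein_1_eq:
  assumes "compact \<Omega>" "\<mu> \<in> prob_measures_on \<Omega>" "\<nu> \<in> prob_measures_on \<Omega>"
  shows "wasserstein 1 \<mu> \<nu> = (INF \<gamma>\<in>transport_plans \<mu> \<nu>. LINT z|\<gamma>. dist (fst z) (snd z))"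
proof -
  have "0 \<le> (INF \<gamma>\<in>transport_plans \<mu> \<nu>. LINT z|\<gamma>. dist (fst z) (snd z))"
    by (intro cINF_greatest transport_plans_nonempty[OF assms]) simp
  then show ?thesis by (simp add: wasserstein_def)
qed

lemma wasserstein_2_power2:
  assumes "compact \<Omega>" "\<mu> \<in> prob_measures_on \<Omega>" "\<nu> \<in> prob_measures_on \<Omega>"
  shows "(wasserstein 2 \<mu> \<nu>)\<^sup>2 = (INF \<gamma>\<in>transport_plans \<mu> \<nu>. LINT z|\<gamma>. (dist (fst z) (snd z))\<^sup>2)"
proof -
  have "0 \<le> (INF \<gamma>\<in>transport_plans \<mu> \<nu>. LINT z|\<gamma>. (dist (fst z) (snd z))\<^sup>2)"
    by (intro cINF_greatest transport_plans_nonempty[OF assms]) simp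
  then show ?thesis by (simp add: wasserstein_def powr_half_sqrt)
qed

section \<open>Differentiability of the quadratic transform\<close>

text \<open>
  Translates of \<open>A\<close> by different multiples of \<open>b\<close> are disjoint. Infinitely many translates
  of a bounded piece of \<open>A\<close> with the same measure fit into a ball, so that measure is zero.
\<close>

lemma null_set_if_lines_meet_once:
  fixes A :: "'a::euclidean_space set"
  assumes "closed A" and once: "\<And>x t. \<lbrakk>x \<in> A; x + t *\<^sub>R b \<in> A\<rbrakk> \<Longrightarrow> t = 0"
  shows "A \<in> null_sets lborel"
proof -
  have null: "A \<inter> cball 0 (real n) \<in> null_sets lborel" for n
  proof -
    define K where "K = A \<inter> cball 0 (real n)"
    define s where "s k = inverse (real (Suc k)) *\<^sub>R b" for k
    define T where "T k = (+) (s k) ` K" for k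
    have cK: "compact K" unfolding K_def using \<open>closed A\<close> by (simp add: closed_Int_compact)
    have cT: "compact (T k)" for k unfolding T_def using cK by (rule compact_translation)
    have eq: "emeasure lborel (T k) = emeasure lborel K" for k
    proof -
      have "emeasure lborel (T k) = emeasure (distr lborel borel ((+) (s k))) (T k)"
        by (simp add: lborel_distr_plus)
      also have "\<dots> = emeasure lborel ((+) (s k) -` T k \<inter> space lborel)"
        using cT by (intro emeasure_distr) (auto simp: borel_compact)
      also have "(+) (s k) -` T k \<inter> space lborel = K"
        by (auto simp: T_def)
      finally show ?thesis .
    qed
    have disj: "disjoint_family T"
      unfolding disjoint_family_on_def
    proof (intro ballI impI, rule ccontr)
      fix i j :: nat assume "i \<noteq> j" "T i \<inter> T j \<noteq> {}"
      then obtain x y where xy: "x \<in> K" "y \<in> K" "s i + x = s j + y" by (auto simp: T_def)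
      then have "y = x + (inverse (real (Suc i)) - inverse (real (Suc j))) *\<^sub>R b"
        by (simp add: s_def algebra_simps)
      then have "inverse (real (Suc i)) - inverse (real (Suc j)) = 0"
        using xy by (intro once[of x]) (auto simp: K_def)
      then have "real (Suc i) = real (Suc j)"
        by (simp only: right_minus_eq inverse_eq_iff_eq)
      then show False using \<open>i \<noteq> j\<close> by simp
    qed
    have "(\<Union>k. T k) \<subseteq> cball 0 (n + norm b)"
    proof clarsimp
      fix k y assume "y \<in> T k"
      then obtain x where x: "x \<in> K" "y = s k + x" by (auto simp: T_def)
      have "norm (s k) \<le> norm b"
        unfolding s_def by (simp add: mult_left_le_one_le inverse_le_1_iff)
      then show "norm y \<le> n + norm b"
        using x norm_triangle_ineq[of "s k" x] by (auto simp: K_def)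
    qed
    then have "emeasure lborel (\<Union>k. T k) \<le> emeasure lborel (cball 0 (n + norm b) :: 'a set)"
      by (intro emeasure_mono) auto
    also have "\<dots> < \<infinity>" by (intro emeasure_compact_finite compact_cball)
    finally have "(\<lambda>k. measure lborel (T k)) sums measure lborel (\<Union>k. T k)"
      using cT disj by (intro measure_UNION) (auto simp: borel_compact)
    then have "summable (\<lambda>k::nat. measure lborel K)"
      using eq by (auto simp: measure_def dest: sums_summable)
    then have "measure lborel K = 0" by (simp only: summable_const_iff)
    then have "emeasure lborel K = 0"
      using cK emeasure_compact_finite[of K] by (simp add: emeasure_eq_ennreal_measure)
    then show ?thesis using cK by (auto simp: K_def[symmetric] borel_compact)
  qed
  have "A = (\<Union>n. A \<inter> cball 0 (real n))"
    by (auto simp: real_arch_simple)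
  then show ?thesis using null by (metis null_sets_UN)
qed

definition c2_minimizers :: "'a::euclidean_space set \<Rightarrow> ('a \<Rightarrow> real) \<Rightarrow> 'a \<Rightarrow> 'a set" where
  "c2_minimizers \<Omega> f x =
     {y \<in> \<Omega>. \<forall>z\<in>\<Omega>. 1/2 * (norm (x - y))\<^sup>2 - f y \<le> 1/2 * (norm (x - z))\<^sup>2 - f z}"

lemma c2_minimizers_nonempty:
  assumes "compact \<Omega>" "\<Omega> \<noteq> {}" "continuous_on UNIV f"
  shows "c2_minimizers \<Omega> f x \<noteq> {}"
proof -
  have "continuous_on \<Omega> (\<lambda>y. 1/2 * (norm (x - y))\<^sup>2 - f y)"
    by (intro continuous_intros continuous_on_subset[OF assms(3)]) auto
  from continuous_attains_inf[OF assms(1,2) this] show ?thesis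
    by (auto simp: c2_minimizers_def)
qed

lemma c2_transform_eq_minimizer:
  assumes "y \<in> c2_minimizers \<Omega> f x"
  shows "c2_transform \<Omega> f x = 1/2 * (norm (x - y))\<^sup>2 - f y"
  unfolding c2_transform_def using assms
  by (intro cInf_eq_minimum) (auto simp: c2_minimizers_def)

text \<open>
  Adding the two minimality inequalities cancels \<open>f\<close> and the squared norms and leaves an inner product.
\<close>

lemma c2_minimizers_monotone:
  assumes "y \<in> c2_minimizers \<Omega> f x" "y' \<in> c2_minimizers \<Omega> f x'"
  shows "0 \<le> (x' - x) \<bullet> (y' - y)"
proof -
  have "1/2 * (norm (x - y))\<^sup>2 - f y \<le> 1/2 * (norm (x - y'))\<^sup>2 - f y'"
    "1/2 * (norm (x' - y'))\<^sup>2 - f y' \<le> 1/2 * (norm (x' - y))\<^sup>2 - f y"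
    using assms by (auto simp: c2_minimizers_def)
  then show ?thesis
    unfolding power2_norm_eq_inner by (simp add: algebra_simps inner_commute)
qed

lemma closed_touching_set:
  assumes "compact K" "K \<subseteq> \<Omega>" "continuous_on UNIV f"
  shows "closed {x. \<exists>y\<in>K. y \<in> c2_minimizers \<Omega> f x}"
proof -
  have f: "continuous_on UNIV (\<lambda>z::'a \<times> 'a. f (snd z))"
    by (rule continuous_on_compose2[OF assms(3)]) (auto intro: continuous_intros)
  have "closed {z. \<forall>v. v \<in> \<Omega> \<longrightarrow>
      1/2 * (norm (fst z - snd z))\<^sup>2 - f (snd z) \<le> 1/2 * (norm (fst z - v))\<^sup>2 - f v}"
    by (intro closed_Collect_all closed_Collect_imp open_Collect_const closed_Collect_le
        continuous_intros f)
  then have "closed ((\<lambda>z. (snd z, fst z)) -` {z. \<forall>v. v \<in> \<Omega> \<longrightarrow>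
      1/2 * (norm (fst z - snd z))\<^sup>2 - f (snd z) \<le> 1/2 * (norm (fst z - v))\<^sup>2 - f v})"
    by (rule closed_vimage) (intro continuous_intros)
  from closed_compact_projection[OF assms(1) this]
  have "closed {x. \<exists>y\<in>K. \<forall>v. v \<in> \<Omega> \<longrightarrow>
      1/2 * (norm (x - y))\<^sup>2 - f y \<le> 1/2 * (norm (x - v))\<^sup>2 - f v}"
    by (simp add: Bex_def)
  also have "{x. \<exists>y\<in>K. \<forall>v. v \<in> \<Omega> \<longrightarrow>
      1/2 * (norm (x - y))\<^sup>2 - f y \<le> 1/2 * (norm (x - v))\<^sup>2 - f v} = {x. \<exists>y\<in>K. y \<in> c2_minimizers \<Omega> f x}"
    using assms(2) by (auto simp: c2_minimizers_def)
  finally show ?thesis .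
qed

text \<open>
  If \<open>x\<close> has two minimizers, some coordinate separates them by rational levels \<open>p < q\<close>. Along a line in the
  direction \<open>b\<close> of this coordinate the values \<open>y \<bullet> b\<close> of the minimizers are monotone, so a jump over
  \<open>[p, q]\<close> happens at most once.
\<close>

lemma AE_unique_c2_minimizer:
  fixes \<Omega> :: "'a::euclidean_space set"
  assumes "compact \<Omega>" "\<Omega> \<noteq> {}" "continuous_on UNIV f"
  shows "AE x in lborel. \<exists>y. c2_minimizers \<Omega> f x = {y}"
proof -
  let ?M = "c2_minimizers \<Omega> f"
  define N where "N b p q =
    {x. \<exists>y\<in>\<Omega> \<inter> {y. y \<bullet> b \<le> p}. y \<in> ?M x} \<inter> {x. \<exists>y\<in>\<Omega> \<inter> {y. q \<le> y \<bullet> b}. y \<in> ?M x}" for b p q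
  have null: "N b p q \<in> null_sets lborel" if "p < q" for b p q
  proof (rule null_set_if_lines_meet_once)
    show "closed (N b p q)"
      unfolding N_def
      by (intro closed_Int closed_touching_set assms(3) compact_Int_closed assms(1)
          closed_Collect_le continuous_intros) auto
    fix x t assume x: "x \<in> N b p q" "x + t *\<^sub>R b \<in> N b p q"
    then obtain y y' z z' where
      "y \<in> ?M x" "y \<bullet> b \<le> p" "y' \<in> ?M x" "q \<le> y' \<bullet> b"
      "z \<in> ?M (x + t *\<^sub>R b)" "z \<bullet> b \<le> p" "z' \<in> ?M (x + t *\<^sub>R b)" "q \<le> z' \<bullet> b"
      by (auto simp: N_def)
    then have "0 \<le> t * (z \<bullet> b - y' \<bullet> b)" "0 \<le> t * (z' \<bullet> b - y \<bullet> b)"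
      "z \<bullet> b - y' \<bullet> b < 0" "0 < z' \<bullet> b - y \<bullet> b"
      using c2_minimizers_monotone[of y' \<Omega> f x z "x + t *\<^sub>R b"]
        c2_minimizers_monotone[of y \<Omega> f x z' "x + t *\<^sub>R b"] that
      by (auto simp: inner_commute[of b] inner_diff_left)
    then show "t = 0" by (auto simp: zero_le_mult_iff)
  qed
  have "AE x in lborel. \<forall>b\<in>Basis. \<forall>p\<in>\<rat>. \<forall>q\<in>\<rat>. p < q \<longrightarrow> x \<notin> N b p q"
    by (intro AE_finite_allI AE_ball_countable[THEN iffD2] ballI countable_rat finite_Basis AE_impI)
       (auto intro: AE_not_in null)
  then show ?thesis
  proof eventually_elim
    case (elim x)
    obtain y where y: "y \<in> ?M x" using c2_minimizers_nonempty[OF assms] by blast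
    have *: "z \<bullet> b \<le> y \<bullet> b" if "z \<in> ?M x" "y \<in> ?M x" "b \<in> Basis" for y z b
    proof (rule ccontr)
      assume "\<not> z \<bullet> b \<le> y \<bullet> b"
      then obtain p where p: "p \<in> \<rat>" "y \<bullet> b < p" "p < z \<bullet> b" using Rats_dense_in_real by (meson not_le)
      obtain q where q: "q \<in> \<rat>" "p < q" "q < z \<bullet> b" using p Rats_dense_in_real by blast
      have "y \<in> \<Omega>" "z \<in> \<Omega>" using that by (auto simp: c2_minimizers_def)
      then have "x \<in> N b p q" using that p(2) q(3) unfolding N_def by (blast intro: less_imp_le)
      then show False using elim p q that by blast
    qed
    have "z = y" if "z \<in> ?M x" for z
      using *[OF that y] *[OF y that] by (intro euclidean_eqI[of z y] antisym) auto
    then show ?case using y by blast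
  qed
qed

text \<open>
  Comparing the minimizer \<open>y\<close> at \<open>x\<close> and a minimizer \<open>z\<close> at \<open>x'\<close> at both points bounds the increment
  of the transform from above and below by \<open>(x' - x) \<bullet> (x - y)\<close> and \<open>(x' - x) \<bullet> (x - z)\<close>, up to a quadratic
  term. By compactness and uniqueness \<open>z\<close> tends to \<open>y\<close> as \<open>x'\<close> tends to \<open>x\<close>.
\<close>

lemma GDERIV_c2_transform:
  fixes \<Omega> :: "'a::euclidean_space set"
  assumes "compact \<Omega>" "\<Omega> \<noteq> {}" "continuous_on UNIV f" and y: "c2_minimizers \<Omega> f x = {y}"
  shows "GDERIV (c2_transform \<Omega> f) x :> x - y"
  unfolding gderiv_def has_derivative_at_alt
proof (intro conjI allI impI)
  show "bounded_linear (\<lambda>h. h \<bullet> (x - y))" by (rule bounded_linear_inner_left)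
  fix e :: real assume e: "0 < e"
  define K where "K = \<Omega> \<inter> {z. e / 2 \<le> dist z y}"
  have "open (- {x. \<exists>z\<in>K. z \<in> c2_minimizers \<Omega> f x})"
    unfolding K_def
    by (intro open_Compl closed_touching_set assms(3) compact_Int_closed assms(1)
          closed_Collect_le continuous_intros) auto
  moreover have "x \<in> - {x. \<exists>z\<in>K. z \<in> c2_minimizers \<Omega> f x}"
    using y e by (auto simp: K_def)
  ultimately obtain d where d: "0 < d" "ball x d \<subseteq> - {x. \<exists>z\<in>K. z \<in> c2_minimizers \<Omega> f x}"
    by (meson openE)
  show "\<exists>d>0. \<forall>x'. norm (x' - x) < d \<longrightarrow>
      norm (c2_transform \<Omega> f x' - c2_transform \<Omega> f x - (x' - x) \<bullet> (x - y)) \<le> e * norm (x' - x)"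
  proof (intro exI[of _ "min d e"] conjI allI impI)
    show "0 < min d e" using d e by simp
    fix x' assume x': "norm (x' - x) < min d e"
    obtain z where z: "z \<in> c2_minimizers \<Omega> f x'"
      using c2_minimizers_nonempty[OF assms(1-3)] by blast
    have zO: "z \<in> \<Omega>" and yO: "y \<in> \<Omega>" using z y by (auto simp: c2_minimizers_def)
    have "x' \<in> ball x d" using x' by (simp add: dist_norm norm_minus_commute)
    then have "z \<notin> K" using d(2) z by blast
    then have zy: "norm (z - y) < e / 2" using zO by (simp add: K_def dist_norm)
    have yx: "y \<in> c2_minimizers \<Omega> f x" using y by simp
    define h where "h = x' - x"
    have expand: "1/2 * (norm (x' - v))\<^sup>2 = 1/2 * (norm (x - v))\<^sup>2 + h \<bullet> (x - v) + 1/2 * (norm h)\<^sup>2" for v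
      unfolding power2_norm_eq_inner h_def by (simp add: algebra_simps inner_commute)
    have 1: "c2_transform \<Omega> f x' - c2_transform \<Omega> f x \<le> h \<bullet> (x - y) + 1/2 * (norm h)\<^sup>2"
    proof -
      have "1/2 * (norm (x' - z))\<^sup>2 - f z \<le> 1/2 * (norm (x' - y))\<^sup>2 - f y"
        using z yO unfolding c2_minimizers_def by blast
      then show ?thesis
        unfolding c2_transform_eq_minimizer[OF z] c2_transform_eq_minimizer[OF yx] expand[of y] by simp
    qed
    have 2: "h \<bullet> (x - z) + 1/2 * (norm h)\<^sup>2 \<le> c2_transform \<Omega> f x' - c2_transform \<Omega> f x"
    proof -
      have "1/2 * (norm (x - y))\<^sup>2 - f y \<le> 1/2 * (norm (x - z))\<^sup>2 - f z"
        using yx zO unfolding c2_minimizers_def by blast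
      then show ?thesis
        unfolding c2_transform_eq_minimizer[OF z] c2_transform_eq_minimizer[OF yx] expand[of z] by simp
    qed
    have "h \<bullet> (z - y) \<le> norm h * norm (z - y)" by (rule norm_cauchy_schwarz)
    also have "\<dots> \<le> norm h * (e / 2)" using zy by (intro mult_left_mono) auto
    finally have 3: "h \<bullet> (x - y) - norm h * (e / 2) \<le> h \<bullet> (x - z)" by (simp add: inner_diff_right)
    have 4: "(norm h)\<^sup>2 \<le> norm h * e"
      unfolding power2_eq_square using x' by (intro mult_left_mono) (auto simp: h_def)
    have "0 \<le> norm h * e" using e by simp
    then have "\<bar>c2_transform \<Omega> f x' - c2_transform \<Omega> f x - h \<bullet> (x - y)\<bar> \<le> norm h * e"
      using 1 2 3 4 zero_le_power2[of "norm h"] unfolding abs_le_iff by linarith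
    then show "norm (c2_transform \<Omega> f x' - c2_transform \<Omega> f x - (x' - x) \<bullet> (x - y)) \<le> e * norm (x' - x)"
      by (simp add: h_def mult.commute)
  qed
qed

lemma gradient_eq:
  assumes "GDERIV f x :> D"
  shows "gradient f x = D"
  unfolding gradient_def
proof (rule the_equality, rule assms)
  fix D' assume "GDERIV f x :> D'"
  then have "(\<lambda>h. h \<bullet> D') = (\<lambda>h. h \<bullet> D)"
    using assms has_derivative_unique unfolding gderiv_def by blast
  then show "D' = D" by (metis vector_eq_ldot)
qed

section \<open>Potentials along optimal maps\<close>

text \<open>
  A potential is given on \<open>\<Omega>\<close> only. Composing it with the projection onto \<open>\<Omega>\<close> extends it to the whole space,
  which settles all questions of measurability and continuity.
\<close>

lemma lipschitz_compose_closest_point: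
  assumes "compact \<Omega>" "convex \<Omega>" "\<Omega> \<noteq> {}" "1-lipschitz_on \<Omega> u"
  shows "1-lipschitz_on UNIV (\<lambda>x. u (closest_point \<Omega> x))"
proof (rule lipschitz_onI)
  fix x y
  have "dist (u (closest_point \<Omega> x)) (u (closest_point \<Omega> y)) \<le> 1 * dist (closest_point \<Omega> x) (closest_point \<Omega> y)"
    using assms by (intro lipschitz_onD[OF assms(4)] closest_point_in_set compact_imp_closed)
  also have "\<dots> \<le> 1 * dist x y"
    using closest_point_lipschitz[OF assms(2) compact_imp_closed[OF assms(1)] assms(3)] by simp
  finally show "dist (u (closest_point \<Omega> x)) (u (closest_point \<Omega> y)) \<le> 1 * dist x y" .
qed simp

lemma set_integral_eq_integral:
  fixes u v :: "'a::euclidean_space \<Rightarrow> real"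
  assumes "compact \<Omega>" "\<mu> \<in> prob_measures_on \<Omega>" "v \<in> borel_measurable borel" "\<And>x. x \<in> \<Omega> \<Longrightarrow> u x = v x"
  shows "(LINT x:\<Omega>|\<mu>. u x) = (LINT x|\<mu>. v x)"
proof -
  note \<mu>D = prob_measures_onD[OF assms(2,1)]
  note [measurable] = assms(3) borel_compact[OF assms(1)]
  note [measurable_cong] = \<mu>D(2)
  have "(LINT x:\<Omega>|\<mu>. u x) = (LINT x|\<mu>. indicator \<Omega> x * v x)"
    unfolding set_lebesgue_integral_def
    by (intro Bochner_Integration.integral_cong refl) (auto simp: indicator_def assms(4))
  also have "\<dots> = (LINT x|\<mu>. v x)"
    using \<mu>D(4) by (intro integral_cong_AE) (auto elim!: eventually_mono)
  finally show ?thesis .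
qed

text \<open>
  By duality the cost of the optimal map equals the value of the potential, so
  the function \<open>\<bar>x - S x\<bar> - (u x - u (S x))\<close> has integral zero. It is nonnegative as \<open>u\<close> is 1-Lipschitz.
\<close>

lemma optimal_map_saturates_potential:
  fixes \<Omega> :: "'a::euclidean_space set" and u0 :: "'a \<Rightarrow> real"
  defines "u \<equiv> \<lambda>x. u0 (closest_point \<Omega> x)"
  assumes \<Omega>: "compact \<Omega>" "convex \<Omega>" and \<mu>: "\<mu> \<in> prob_measures_on \<Omega>" and \<nu>: "\<nu> \<in> prob_measures_on \<Omega>"
    and S: "optimal_map_W1 \<mu> \<nu> S" and u0: "kantorovich_potential \<Omega> \<mu> \<nu> u0"
  shows "AE x in \<mu>. u x - u (S x) = dist x (S x)"
proof -
  note \<mu>D = prob_measures_onD[OF \<mu> \<Omega>(1)]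
  interpret M: prob_space \<mu> by (rule \<mu>D)
  note [measurable_cong] = \<mu>D(2)
  have Sm[measurable]: "S \<in> borel_measurable borel" and S\<nu>: "distr \<mu> borel S = \<nu>"
    using S by (auto simp: optimal_map_W1_def)
  have u: "1-lipschitz_on UNIV u"
    unfolding u_def using \<Omega> \<mu>D(5) u0
    by (intro lipschitz_compose_closest_point) (auto simp: kantorovich_potential_def is_arg_max_def)
  note um[measurable] = lipschitz_1_borel_measurable[OF u]
  define \<gamma>0 where "\<gamma>0 = distr \<mu> borel (\<lambda>x. (x, S x))"
  have \<gamma>0: "\<gamma>0 \<in> transport_plans \<mu> \<nu>"
    and opt: "\<And>\<gamma>. \<gamma> \<in> transport_plans \<mu> \<nu> \<Longrightarrow> (LINT z|\<gamma>0. dist (fst z) (snd z)) \<le> (LINT z|\<gamma>. dist (fst z) (snd z))"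
    using S by (auto simp: optimal_map_W1_def is_arg_min_def \<gamma>0_def dist_norm not_less)
  have uu0: "(LINT x:\<Omega>|m. u0 x) = (LINT x|m. u x)" if "m \<in> prob_measures_on \<Omega>" for m
    using \<Omega>(1) that um by (rule set_integral_eq_integral) (simp add: u_def closest_point_self)
  have cost: "(LINT z|\<gamma>0. dist (fst z) (snd z)) = (LINT x|\<mu>. dist x (S x))"
    unfolding \<gamma>0_def using plan_of_maps(2)[OF \<mu>D(2), of "\<lambda>x. x" S "\<lambda>z. dist (fst z) (snd z)"]
      borel_measurable_continuous_onI[OF continuous_dist_pair] by simp
  have "(LINT x|\<mu>. dist x (S x)) \<le> (LINT x|\<mu>. u x) - (LINT y|\<nu>. u y)"
  proof (rule field_le_epsilon)
    fix e :: real assume "0 < e"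
    then obtain \<gamma> v where \<gamma>: "\<gamma> \<in> transport_plans \<mu> \<nu>" and v: "1-lipschitz_on UNIV v"
      and le: "(LINT z|\<gamma>. dist (fst z) (snd z)) \<le> (LINT x|\<mu>. v x) - (LINT y|\<nu>. v y) + e"
      using kantorovich_duality_approx[OF \<Omega>(1) \<mu> \<nu>] by blast
    have "(LINT x:\<Omega>|\<mu>. v x) - (LINT y:\<Omega>|\<nu>. v y) \<le> (LINT x:\<Omega>|\<mu>. u0 x) - (LINT y:\<Omega>|\<nu>. u0 y)"
      using u0 lipschitz_on_subset[OF v subset_UNIV, of \<Omega>]
      by (auto simp: kantorovich_potential_def is_arg_max_def not_less)
    then have "(LINT x|\<mu>. v x) - (LINT y|\<nu>. v y) \<le> (LINT x|\<mu>. u x) - (LINT y|\<nu>. u y)"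
      using set_integral_eq_integral[OF \<Omega>(1) \<mu> lipschitz_1_borel_measurable[OF v] refl]
        set_integral_eq_integral[OF \<Omega>(1) \<nu> lipschitz_1_borel_measurable[OF v] refl]
      by (simp add: uu0 \<mu> \<nu>)
    then show "(LINT x|\<mu>. dist x (S x)) \<le> (LINT x|\<mu>. u x) - (LINT y|\<nu>. u y) + e"
      using le opt[OF \<gamma>] by (simp add: cost)
  qed
  also have "(LINT y|\<nu>. u y) = (LINT x|\<mu>. u (S x))"
    unfolding S\<nu>[symmetric] by (rule integral_distr) auto
  finally have le: "(LINT x|\<mu>. dist x (S x)) \<le> (LINT x|\<mu>. u x) - (LINT x|\<mu>. u (S x))" .
  have int: "integrable \<mu> u" "integrable \<mu> (\<lambda>x. u (S x))" "integrable \<mu> (\<lambda>x. dist x (S x))"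
  proof -
    show "integrable \<mu> u" by (rule integrable_lipschitz_1[OF u \<mu> \<Omega>(1)])
    show "integrable \<mu> (\<lambda>x. u (S x))"
      using integrable_lipschitz_1[OF u \<nu> \<Omega>(1)] unfolding S\<nu>[symmetric] by (subst (asm) integrable_distr_eq) auto
    have "integrable \<gamma>0 (\<lambda>z. dist (fst z) (snd z))"
      by (rule integrable_continuous_plan[OF \<Omega>(1) \<mu> \<nu> \<gamma>0 continuous_dist_pair])
    then show "integrable \<mu> (\<lambda>x. dist x (S x))"
      unfolding \<gamma>0_def
      by (subst (asm) integrable_distr_eq) (auto simp: borel_measurable_continuous_onI[OF continuous_dist_pair])
  qed
  have nonneg: "0 \<le> dist x (S x) - (u x - u (S x))" for x using lipschitz_1_diff_le[OF u, of x "S x"] by simp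
  have "(LINT x|\<mu>. dist x (S x) - (u x - u (S x))) \<le> 0" using le int by simp
  then have "(LINT x|\<mu>. dist x (S x) - (u x - u (S x))) = 0"
    using nonneg by (intro antisym integral_nonneg_AE) auto
  then have "AE x in \<mu>. dist x (S x) - (u x - u (S x)) = 0"
    using nonneg int by (subst (asm) integral_nonneg_eq_0_iff_AE) auto
  then show ?thesis by eventually_elim simp
qed

text \<open>
  A point at distance \<open>r\<close> from \<open>x\<close> costs at least \<open>r\<^sup>2 / 2 + lam * (u x - r)\<close>, which is least for \<open>r = lam\<close>. The
  point at distance \<open>lam\<close> on the segment from \<open>x\<close> to \<open>t\<close> attains this bound, since \<open>u\<close> decreases with slope one there.
\<close>

lemma c2_minimizer_on_ray:
  fixes x t :: "'a::euclidean_space"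
  assumes "convex \<Omega>" "x \<in> \<Omega>" "t \<in> \<Omega>" and u: "1-lipschitz_on UNIV u"
    and sat: "u x - u t = dist x t" and lam: "0 < lam" "lam < dist x t"
  obtains y where "y \<in> c2_minimizers \<Omega> (\<lambda>y. - lam * u y) x" "u y - u t = dist y t"
proof -
  define s where "s = lam / dist x t"
  define y where "y = (1 - s) *\<^sub>R x + s *\<^sub>R t"
  have "0 < dist x t" using lam by linarith
  then have s: "0 \<le> s" "s \<le> 1" using lam by (auto simp: s_def)
  have "y \<in> \<Omega>" unfolding y_def using assms(1-3) s by (intro convexD_alt) auto
  have "x - y = s *\<^sub>R (x - t)" "y - t = (1 - s) *\<^sub>R (x - t)" by (auto simp: y_def algebra_simps)
  then have xy: "dist x y = lam" and yt: "dist y t = dist x t - lam"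
    using s lam by (auto simp: dist_norm s_def left_diff_distrib)
  have uxy: "u x - u y = lam" and uyt: "u y - u t = dist y t"
    using lipschitz_1_diff_le[OF u, of x y] lipschitz_1_diff_le[OF u, of y t] sat xy yt by auto
  have "1/2 * (norm (x - y))\<^sup>2 - - lam * u y \<le> 1/2 * (norm (x - z))\<^sup>2 - - lam * u z" for z
  proof -
    have "lam * (u x - u z) \<le> lam * dist x z"
      using lam lipschitz_1_diff_le[OF u, of x z] by (intro mult_left_mono) auto
    moreover have "0 \<le> (dist x z - lam)\<^sup>2" by simp
    moreover have "lam * (u x - u y) = lam * lam" using uxy by simp
    ultimately show ?thesis
      using xy by (simp add: dist_norm power2_eq_square algebra_simps)
  qed
  then have "y \<in> c2_minimizers \<Omega> (\<lambda>y. - lam * u y) x"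
    using \<open>y \<in> \<Omega>\<close> by (simp add: c2_minimizers_def)
  then show ?thesis using that uyt by blast
qed

section \<open>Uniqueness by concentration of plans\<close>

text \<open>
  If \<open>X\<close> lies in \<open>C\<close>, then \<open>Y\<close> lies in a small neighbourhood of \<open>C\<close> unless it is far from \<open>X\<close>. The
  closed neighbourhoods decrease to \<open>C\<close>.
\<close>

lemma measure_closed_le_if_close_in_probability:
  fixes m1 m2 :: "'b::euclidean_space measure"
  assumes close: "\<And>s \<eta>. \<lbrakk>0 < s; 0 < \<eta>\<rbrakk> \<Longrightarrow> \<exists>(\<gamma> :: 'c measure) X Y. prob_space \<gamma> \<and> X \<in> borel_measurable \<gamma> \<and> Y \<in> borel_measurable \<gamma> \<and>
      distr \<gamma> borel X = m1 \<and> distr \<gamma> borel Y = m2 \<and> measure \<gamma> {z \<in> space \<gamma>. s < dist (X z) (Y z)} < \<eta>"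
    and "finite_measure m2" and sets: "sets m2 = sets borel" and C: "closed C"
  shows "measure m1 C \<le> measure m2 C"
proof (cases "C = {}")
  case False
  interpret m2: finite_measure m2 by fact
  define N where "N n = {y. infdist y C \<le> inverse (real (Suc n))}" for n
  have N: "closed (N n)" for n
    unfolding N_def by (intro closed_Collect_le continuous_intros)
  have "(\<lambda>n. measure m2 (N n)) \<longlonglongrightarrow> measure m2 (\<Inter>n. N n)"
  proof (rule m2.finite_Lim_measure_decseq)
    show "range N \<subseteq> sets m2" using N by (auto simp: sets)
    show "decseq N"
      unfolding decseq_def N_def by (auto intro: order_trans le_imp_inverse_le)
  qed
  also have "(\<Inter>n. N n) = C"
  proof (intro equalityI subsetI)
    fix y assume "y \<in> (\<Inter>n. N n)"
    then have "infdist y C \<le> inverse (real (Suc n))" for n by (auto simp: N_def)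
    then have "infdist y C \<le> 0" by (intro LIMSEQ_le_const[OF LIMSEQ_inverse_real_of_nat]) auto
    then show "y \<in> C" using C False in_closed_iff_infdist_zero[of C y] infdist_nonneg[of y C] by auto
  qed (auto simp: N_def)
  finally have lim: "(\<lambda>n. measure m2 (N n)) \<longlonglongrightarrow> measure m2 C" .
  have "measure m1 C \<le> measure m2 (N n)" for n
  proof (rule field_le_epsilon)
    fix \<eta> :: real assume "0 < \<eta>"
    define s where "s = inverse (real (Suc n))"
    have "0 < s" by (simp add: s_def)
    from close[OF this \<open>0 < \<eta>\<close>] obtain \<gamma> :: "'c measure" and X Y where "prob_space \<gamma>"
      and [measurable]: "X \<in> borel_measurable \<gamma>" "Y \<in> borel_measurable \<gamma>"
      and m: "distr \<gamma> borel X = m1" "distr \<gamma> borel Y = m2"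
      and bad: "measure \<gamma> {z \<in> space \<gamma>. s < dist (X z) (Y z)} < \<eta>" by blast
    interpret \<gamma>: prob_space \<gamma> by fact
    have [measurable]: "C \<in> sets borel" "N n \<in> sets borel" using C N by auto
    have "measure m1 C = measure \<gamma> (X -` C \<inter> space \<gamma>)"
      unfolding m[symmetric] by (rule measure_distr) auto
    also have "\<dots> \<le> measure \<gamma> ((Y -` N n \<inter> space \<gamma>) \<union> {z \<in> space \<gamma>. s < dist (X z) (Y z)})"
    proof (rule \<gamma>.finite_measure_mono)
      have "infdist (Y z) C \<le> s" if "X z \<in> C" "\<not> s < dist (X z) (Y z)" for z
        using infdist_le[OF that(1), of "Y z"] that(2) by (simp add: dist_commute)
      then show "X -` C \<inter> space \<gamma> \<subseteq> (Y -` N n \<inter> space \<gamma>) \<union> {z \<in> space \<gamma>. s < dist (X z) (Y z)}"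
        by (auto simp: N_def s_def)
    qed measurable
    also have "\<dots> \<le> measure \<gamma> (Y -` N n \<inter> space \<gamma>) + measure \<gamma> {z \<in> space \<gamma>. s < dist (X z) (Y z)}"
      by (rule measure_Un_le) measurable
    also have "measure \<gamma> (Y -` N n \<inter> space \<gamma>) = measure m2 (N n)"
      unfolding m[symmetric] by (rule measure_distr[symmetric]) auto
    finally show "measure m1 C \<le> measure m2 (N n) + \<eta>" using bad by simp
  qed
  then show ?thesis by (intro LIMSEQ_le_const[OF lim]) auto
qed simp

lemma measure_eqI_closed:
  fixes m1 m2 :: "'b::topological_space measure"
  assumes "finite_measure m1" "finite_measure m2" "sets m1 = sets borel" "sets m2 = sets borel"
    and "\<And>C. closed C \<Longrightarrow> measure m1 C = measure m2 C"
  shows "m1 = m2"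
proof (rule measure_eqI_generator_eq[of "Collect closed" UNIV _ _ "\<lambda>_. UNIV"])
  interpret m1: finite_measure m1 by fact
  interpret m2: finite_measure m2 by fact
  show "Int_stable (Collect closed)" by (auto simp: Int_stable_def)
  show "emeasure m1 X = emeasure m2 X" if "X \<in> Collect closed" for X
    using that assms(5) by (simp add: m1.emeasure_eq_measure m2.emeasure_eq_measure)
  show "sets m1 = sigma_sets UNIV (Collect closed)" "sets m2 = sigma_sets UNIV (Collect closed)"
    using assms(3,4) by (simp_all add: borel_eq_closed)
  show "emeasure m1 UNIV \<noteq> \<infinity>" for i :: nat by (simp add: m1.emeasure_eq_measure)
qed auto

text \<open>
  Under such plans \<open>(x, y) \<mapsto> y\<close> and \<open>(x, y) \<mapsto> T x\<close> are close in probability while their laws \<open>\<rho>\<close> and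
  \<open>T\<^sub>#\<mu>\<close> are fixed, so each law is dominated by the other on closed sets.
\<close>

lemma eq_distr_if_plans_concentrate_on_graph:
  fixes T :: "'a::euclidean_space \<Rightarrow> 'a"
  assumes \<mu>: "prob_space \<mu>" "sets \<mu> = sets borel" and \<rho>: "prob_space \<rho>" "sets \<rho> = sets borel"
    and T: "T \<in> borel_measurable borel"
    and close: "\<And>s \<eta>. \<lbrakk>0 < s; 0 < \<eta>\<rbrakk> \<Longrightarrow> \<exists>\<gamma>\<in>transport_plans \<mu> \<rho>. measure \<gamma> {z. s < dist (snd z) (T (fst z))} < \<eta>"
  shows "\<rho> = distr \<mu> borel T"
proof (rule measure_eqI_closed)
  interpret M: prob_space \<mu> by fact
  interpret R: prob_space \<rho> by fact
  have "T \<in> borel_measurable \<mu>" using T by (simp add: measurable_cong_sets[OF \<mu>(2) refl])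
  then interpret TM: prob_space "distr \<mu> borel T" by (rule M.prob_space_distr)
  show "finite_measure \<rho>" "finite_measure (distr \<mu> borel T)"
    by (rule R.finite_measure_axioms TM.finite_measure_axioms)+
  show "sets \<rho> = sets borel" "sets (distr \<mu> borel T) = sets borel" by (simp_all add: \<rho>)
  have plan: "prob_space \<gamma>" "space \<gamma> = UNIV" "snd \<in> borel_measurable \<gamma>" "(\<lambda>z. T (fst z)) \<in> borel_measurable \<gamma>"
    "distr \<gamma> borel snd = \<rho>" "distr \<gamma> borel (\<lambda>z. T (fst z)) = distr \<mu> borel T"
    if \<gamma>: "\<gamma> \<in> transport_plans \<mu> \<rho>" for \<gamma>
  proof -
    note \<gamma>D = transport_planD[OF \<gamma> \<mu>(1)]
    show "prob_space \<gamma>" "space \<gamma> = UNIV" "snd \<in> borel_measurable \<gamma>" "(\<lambda>z. T (fst z)) \<in> borel_measurable \<gamma>"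
      using \<gamma>D sets_eq_imp_space_eq[OF \<gamma>D(2)] measurable_compose[OF \<gamma>D(3) T] by auto
    show "distr \<gamma> borel snd = \<rho>" "distr \<gamma> borel (\<lambda>z. T (fst z)) = distr \<mu> borel T"
      using \<gamma> distr_distr[OF T \<gamma>D(3)] by (auto simp: transport_plans_def comp_def)
  qed
  fix C :: "'a set" assume C: "closed C"
  show "measure \<rho> C = measure (distr \<mu> borel T) C"
  proof (rule antisym)
    show "measure \<rho> C \<le> measure (distr \<mu> borel T) C"
    proof (rule measure_closed_le_if_close_in_probability[OF _ TM.finite_measure_axioms _ C])
      fix s \<eta> :: real assume "0 < s" "0 < \<eta>"
      from close[OF this] obtain \<gamma> where \<gamma>: "\<gamma> \<in> transport_plans \<mu> \<rho>"
        and *: "measure \<gamma> {z. s < dist (snd z) (T (fst z))} < \<eta>" by blast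
      show "\<exists>(\<gamma> :: ('a \<times> 'a) measure) X Y. prob_space \<gamma> \<and> X \<in> borel_measurable \<gamma> \<and> Y \<in> borel_measurable \<gamma> \<and>
        distr \<gamma> borel X = \<rho> \<and> distr \<gamma> borel Y = distr \<mu> borel T \<and> measure \<gamma> {z \<in> space \<gamma>. s < dist (X z) (Y z)} < \<eta>"
        using plan[OF \<gamma>] * by (intro exI[of _ \<gamma>] exI[of _ snd] exI[of _ "\<lambda>z. T (fst z)"]) auto
    qed simp
    show "measure (distr \<mu> borel T) C \<le> measure \<rho> C"
    proof (rule measure_closed_le_if_close_in_probability[OF _ R.finite_measure_axioms \<rho>(2) C])
      fix s \<eta> :: real assume "0 < s" "0 < \<eta>"
      from close[OF this] obtain \<gamma> where \<gamma>: "\<gamma> \<in> transport_plans \<mu> \<rho>"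
        and *: "measure \<gamma> {z. s < dist (snd z) (T (fst z))} < \<eta>" by blast
      show "\<exists>(\<gamma> :: ('a \<times> 'a) measure) X Y. prob_space \<gamma> \<and> X \<in> borel_measurable \<gamma> \<and> Y \<in> borel_measurable \<gamma> \<and>
        distr \<gamma> borel X = distr \<mu> borel T \<and> distr \<gamma> borel Y = \<rho> \<and> measure \<gamma> {z \<in> space \<gamma>. s < dist (X z) (Y z)} < \<eta>"
        using plan[OF \<gamma>] * by (intro exI[of _ \<gamma>] exI[of _ snd] exI[of _ "\<lambda>z. T (fst z)"]) (auto simp: dist_commute)
    qed
  qed
qed

text \<open>
  Where \<open>T x\<close> is a minimizer this is \<open>\<bar>x - y\<bar>\<^sup>2 / 2 - f y - f\<^sup>c x\<close>, the slack in the pointwise inequality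
  behind the lower bound. The form with \<open>T\<close> in place of the infimum \<open>f\<^sup>c\<close> is visibly Borel.
\<close>

definition c2_gap :: "('a::euclidean_space \<Rightarrow> real) \<Rightarrow> ('a \<Rightarrow> 'a) \<Rightarrow> 'a \<Rightarrow> 'a \<Rightarrow> real" where
  "c2_gap f T x y = (1/2 * (dist x y)\<^sup>2 - f y) - (1/2 * (dist x (T x))\<^sup>2 - f (T x))"

lemma c2_gap_nonneg:
  assumes "c2_minimizers \<Omega> f x = {T x}" "y \<in> \<Omega>"
  shows "0 \<le> c2_gap f T x y"
proof -
  have "T x \<in> c2_minimizers \<Omega> f x" using assms by simp
  then show ?thesis using assms(2) by (auto simp: c2_minimizers_def c2_gap_def dist_norm)
qed

lemma c2_gap_pos_away_from_minimizer:
  assumes "compact \<Omega>" "continuous_on UNIV f" and T: "c2_minimizers \<Omega> f x = {T x}" and "0 < s"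
  obtains n where "\<And>y. \<lbrakk>y \<in> \<Omega>; s < dist y (T x)\<rbrakk> \<Longrightarrow> inverse (real (Suc n)) \<le> c2_gap f T x y"
proof -
  define K where "K = \<Omega> \<inter> {y. s \<le> dist y (T x)}"
  have K: "compact K"
    unfolding K_def using assms(1) by (intro compact_Int_closed closed_Collect_le continuous_intros)
  have "continuous_on UNIV (c2_gap f T x)"
    unfolding c2_gap_def by (intro continuous_intros assms(2))
  then have cont: "continuous_on K (c2_gap f T x)" by (rule continuous_on_subset) simp
  show ?thesis
  proof (cases "K = {}")
    case True
    then show ?thesis by (intro that[of 0]) (auto simp: K_def)
  next
    case False
    obtain y0 where y0: "y0 \<in> K" and min: "\<And>y. y \<in> K \<Longrightarrow> c2_gap f T x y0 \<le> c2_gap f T x y"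
      using continuous_attains_inf[OF K False cont] by blast
    have "c2_gap f T x y0 \<noteq> 0"
    proof
      assume "c2_gap f T x y0 = 0"
      then have "y0 \<in> c2_minimizers \<Omega> f x"
        using y0 c2_gap_nonneg[where T = T, OF T] by (auto simp: c2_minimizers_def K_def c2_gap_def dist_norm)
      then show False using T y0 \<open>0 < s\<close> by (auto simp: K_def)
    qed
    then have "0 < c2_gap f T x y0" using c2_gap_nonneg[where T = T, OF T, of y0] y0 by (auto simp: K_def)
    then obtain n where "inverse (real (Suc n)) < c2_gap f T x y0" using reals_Archimedean by blast
    then show ?thesis using min by (intro that[of n]) (force simp: K_def)
  qed
qed

text \<open>
  Away from \<open>T x\<close> the gap at \<open>x\<close> has a positive lower bound, which depends on \<open>x\<close>. This bound exceeds a common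
  constant for all \<open>x\<close> outside a set \<open>E n\<close> of small measure. For such \<open>x\<close>, Markov's inequality limits the mass that
  a plan with a small average gap can send far away from \<open>T x\<close>.
\<close>

lemma eq_distr_if_near_optimal_plans:
  fixes T :: "'a::euclidean_space \<Rightarrow> 'a"
  assumes \<Omega>: "compact \<Omega>" and \<mu>: "\<mu> \<in> prob_measures_on \<Omega>" and \<rho>: "\<rho> \<in> prob_measures_on \<Omega>"
    and f: "continuous_on UNIV f" and T[measurable]: "T \<in> borel_measurable borel"
    and min: "AE x in \<mu>. c2_minimizers \<Omega> f x = {T x}"
    and near: "\<And>e. 0 < e \<Longrightarrow> \<exists>\<gamma>\<in>transport_plans \<mu> \<rho>. integrable \<gamma> (\<lambda>z. c2_gap f T (fst z) (snd z)) \<and>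
                 (LINT z|\<gamma>. c2_gap f T (fst z) (snd z)) \<le> e"
  shows "\<rho> = distr \<mu> borel T"
proof -
  note \<mu>D = prob_measures_onD[OF \<mu> \<Omega>] and \<rho>D = prob_measures_onD[OF \<rho> \<Omega>]
  interpret M: prob_space \<mu> by (rule \<mu>D)
  have [measurable]: "f \<in> borel_measurable borel" using f by (rule borel_measurable_continuous_onI)
  obtain D where D: "countable D" "D \<subseteq> \<Omega>" "\<Omega> \<subseteq> closure D" by (rule separable)
  show ?thesis
  proof (rule eq_distr_if_plans_concentrate_on_graph[OF \<mu>D(1,2) \<rho>D(1,2) T])
    fix s \<eta> :: real assume s: "0 < s" and \<eta>: "0 < \<eta>"
    \<comment> \<open>A countable dense subset suffices by continuity in \<open>q\<close>, and keeps the set Borel.\<close>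
    define E where "E n = (\<Union>q\<in>D. {x. s < dist q (T x) \<and> c2_gap f T x q < inverse (real (Suc n))})" for n
    have [measurable]: "E n \<in> sets borel" for n
    proof -
      have "{x \<in> space borel. s < dist q (T x) \<and> c2_gap f T x q < inverse (real (Suc n))} \<in> sets borel" for q
        unfolding c2_gap_def by measurable
      then show ?thesis unfolding E_def by (intro sets.countable_UN'' D(1)) simp
    qed
    have E: "inverse (real (Suc n)) \<le> c2_gap f T x y" if x: "x \<notin> E n" and y: "y \<in> \<Omega>" "s < dist y (T x)" for n x y
    proof (rule ccontr)
      assume neg: "\<not> inverse (real (Suc n)) \<le> c2_gap f T x y"
      define U where "U = {q. s < dist q (T x) \<and> c2_gap f T x q < inverse (real (Suc n))}"
      have "open U"
        unfolding U_def c2_gap_def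
        by (intro open_Collect_conj open_Collect_less continuous_intros f)
      moreover have "y \<in> U \<inter> closure D" using neg y D(3) by (auto simp: U_def)
      ultimately have "U \<inter> D \<noteq> {}" using open_Int_closure_eq_empty by blast
      then obtain q where "q \<in> D" "s < dist q (T x)" "c2_gap f T x q < inverse (real (Suc n))"
        by (auto simp: U_def)
      then show False using x by (auto simp: E_def)
    qed
    have "(\<lambda>n. M.prob (E n)) \<longlonglongrightarrow> M.prob (\<Inter>n. E n)"
    proof (rule M.finite_Lim_measure_decseq)
      show "range E \<subseteq> sets \<mu>" by (auto simp: \<mu>D)
      show "decseq E"
      proof (rule decseq_SucI)
        show "E (Suc n) \<subseteq> E n" for n
        proof -
          have "inverse (real (Suc (Suc n))) \<le> inverse (real (Suc n))" by (intro le_imp_inverse_le) auto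
          then show ?thesis unfolding E_def by (auto simp: less_le_trans)
        qed
      qed
    qed
    moreover have "M.prob (\<Inter>n. E n) = 0"
    proof -
      have "AE x in \<mu>. x \<notin> (\<Inter>n. E n)"
        using min
      proof eventually_elim
        case (elim x)
        obtain n where "\<And>y. \<lbrakk>y \<in> \<Omega>; s < dist y (T x)\<rbrakk> \<Longrightarrow> inverse (real (Suc n)) \<le> c2_gap f T x y"
          using c2_gap_pos_away_from_minimizer[where T = T, OF \<Omega> f elim s] by blast
        then have "x \<notin> E n" using D(2) by (force simp: E_def)
        then show ?case by blast
      qed
      then show ?thesis by (subst M.prob_eq_0) (auto simp: \<mu>D)
    qed
    ultimately have "(\<lambda>n. M.prob (E n)) \<longlonglongrightarrow> 0" by simp
    then have "eventually (\<lambda>n. M.prob (E n) < \<eta> / 2) sequentially"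
      using \<eta> by (intro order_tendstoD) auto
    then obtain n where n: "M.prob (E n) < \<eta> / 2" using eventually_happens by force
    define c where "c = inverse (real (Suc n))"
    have c: "0 < c" by (simp add: c_def)
    obtain \<gamma> where \<gamma>: "\<gamma> \<in> transport_plans \<mu> \<rho>"
      and int: "integrable \<gamma> (\<lambda>z. c2_gap f T (fst z) (snd z))"
      and le: "(LINT z|\<gamma>. c2_gap f T (fst z) (snd z)) \<le> c * \<eta> / 4"
      using near[of "c * \<eta> / 4"] c \<eta> by auto
    note \<gamma>D = transport_planD[OF \<gamma> \<mu>D(1)]
    interpret G: prob_space \<gamma> by (rule \<gamma>D)
    have space: "space \<gamma> = UNIV" using sets_eq_imp_space_eq[OF \<gamma>D(2)] by simp
    note [measurable] = \<gamma>D(3,4) int[THEN borel_measurable_integrable]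
    have nonneg: "AE z in \<gamma>. 0 \<le> c2_gap f T (fst z) (snd z)"
      using AE_transport_plan(1)[OF \<gamma> \<mu>D(1) min] AE_transport_plan(2)[OF \<gamma> \<mu>D(1) \<rho>D(4)]
      by eventually_elim (rule c2_gap_nonneg[where T = T])
    have "G.prob {z. s < dist (snd z) (T (fst z))}
        \<le> G.prob ({z \<in> space \<gamma>. fst z \<in> E n} \<union> {z \<in> space \<gamma>. c \<le> c2_gap f T (fst z) (snd z)})"
    proof (rule G.finite_measure_mono_AE)
      show "AE z in \<gamma>. z \<in> {z. s < dist (snd z) (T (fst z))} \<longrightarrow>
          z \<in> {z \<in> space \<gamma>. fst z \<in> E n} \<union> {z \<in> space \<gamma>. c \<le> c2_gap f T (fst z) (snd z)}"
        using AE_transport_plan(2)[OF \<gamma> \<mu>D(1) \<rho>D(4)]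
        by eventually_elim (use E in \<open>auto simp: c_def space\<close>)
    qed measurable
    also have "\<dots> \<le> G.prob {z \<in> space \<gamma>. fst z \<in> E n} + G.prob {z \<in> space \<gamma>. c \<le> c2_gap f T (fst z) (snd z)}"
      by (rule measure_Un_le) measurable
    also have "G.prob {z \<in> space \<gamma>. fst z \<in> E n} = M.prob (E n)"
    proof -
      have "M.prob (E n) = measure (distr \<gamma> borel fst) (E n)" using \<gamma> by (simp add: transport_plans_def)
      also have "\<dots> = G.prob (fst -` E n \<inter> space \<gamma>)" by (rule measure_distr) auto
      also have "fst -` E n \<inter> space \<gamma> = {z \<in> space \<gamma>. fst z \<in> E n}" by auto
      finally show ?thesis by simp
    qed
    also have "G.prob {z \<in> space \<gamma>. c \<le> c2_gap f T (fst z) (snd z)}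
        \<le> (LINT z|\<gamma>. c2_gap f T (fst z) (snd z)) / c"
      using integral_Markov_inequality_measure[OF int, of "{}" c] nonneg c by simp
    also have "\<dots> \<le> \<eta> / 4" using le c by (simp add: divide_le_eq mult.commute)
    finally have "G.prob {z. s < dist (snd z) (T (fst z))} < \<eta>" using n \<eta> by simp
    then show "\<exists>\<gamma>\<in>transport_plans \<mu> \<rho>. measure \<gamma> {z. s < dist (snd z) (T (fst z))} < \<eta>"
      using \<gamma> by blast
  qed
qed

section \<open>The minimizer\<close>

lemma distr_in_prob_measures_on:
  fixes T :: "'a::euclidean_space \<Rightarrow> 'a"
  assumes \<Omega>: "compact \<Omega>" and \<mu>: "\<mu> \<in> prob_measures_on \<Omega>" and T: "T \<in> borel_measurable borel"
    and T_in: "AE x in \<mu>. T x \<in> \<Omega>"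
  shows "distr \<mu> borel T \<in> prob_measures_on \<Omega>"
proof -
  note \<mu>D = prob_measures_onD[OF \<mu> \<Omega>]
  interpret M: prob_space \<mu> by (rule \<mu>D)
  note [measurable_cong] = \<mu>D(2) and [measurable] = T
  interpret R: prob_space "distr \<mu> borel T" by (rule M.prob_space_distr) measurable
  have \<Omega>_borel[measurable]: "\<Omega> \<in> sets borel" using \<Omega> by (rule borel_compact)
  have "AE y in distr \<mu> borel T. y \<in> \<Omega>" using T_in by (subst AE_distr_iff) auto
  then have "R.prob \<Omega> = 1" by (subst R.prob_eq_1) auto
  then show ?thesis
    using R.prob_space_axioms by (simp add: prob_measures_on_def R.emeasure_eq_measure)
qed

text \<open>
  The lower bound \<open>V\<close> of the objective is the integral form of the pointwise inequality plus
  weak duality. The assumption \<open>dual\<close> says that \<open>u\<close> is an optimal potential between \<open>T\<^sub>#\<mu>\<close> and \<open>\<nu>\<close>, so that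
  \<open>T\<^sub>#\<mu>\<close> attains \<open>V\<close>. Any measure that attains \<open>V\<close> has plans with arbitrarily small average gap.
\<close>

lemma objective_characterization:
  fixes \<Omega> :: "'a::euclidean_space set" and T :: "'a \<Rightarrow> 'a" and u :: "'a \<Rightarrow> real" and lam :: real
  defines "f \<equiv> \<lambda>y. - lam * u y"
  assumes \<Omega>: "compact \<Omega>" and \<mu>: "\<mu> \<in> prob_measures_on \<Omega>" and \<nu>: "\<nu> \<in> prob_measures_on \<Omega>"
    and lam: "0 < lam" and u: "1-lipschitz_on UNIV u" and T[measurable]: "T \<in> borel_measurable borel"
    and min: "AE x in \<mu>. c2_minimizers \<Omega> f x = {T x}"
    and dual: "wasserstein 1 (distr \<mu> borel T) \<nu> \<le> (LINT y|distr \<mu> borel T. u y) - (LINT y|\<nu>. u y)"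
  shows "{\<rho>. is_arg_min (\<lambda>\<rho>. 1/2 * (wasserstein 2 \<mu> \<rho>)\<^sup>2 + lam * wasserstein 1 \<rho> \<nu>)
              (\<lambda>\<rho>. \<rho> \<in> prob_measures_on \<Omega>) \<rho>} = {distr \<mu> borel T}"
proof -
  note \<mu>D = prob_measures_onD[OF \<mu> \<Omega>]
  interpret M: prob_space \<mu> by (rule \<mu>D)
  note [measurable_cong] = \<mu>D(2)
  define F where "F \<rho> = 1/2 * (wasserstein 2 \<mu> \<rho>)\<^sup>2 + lam * wasserstein 1 \<rho> \<nu>" for \<rho>
  define \<rho>0 where "\<rho>0 = distr \<mu> borel T"
  define G where "G x = 1/2 * (dist x (T x))\<^sup>2 - f (T x)" for x
  define V where "V = (LINT x|\<mu>. G x) - lam * (LINT y|\<nu>. u y)"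
  have cu: "continuous_on UNIV u" using u by (rule lipschitz_on_continuous_on)
  have cf: "continuous_on UNIV f" unfolding f_def by (intro continuous_intros cu)
  note [measurable] = borel_measurable_continuous_onI[OF cu] borel_measurable_continuous_onI[OF cf]
  have [measurable]: "G \<in> borel_measurable borel" unfolding G_def by measurable
  have T_in: "AE x in \<mu>. T x \<in> \<Omega>"
    using min by eventually_elim (auto simp: c2_minimizers_def)
  have bounded: "bounded ((\<lambda>z. 1/2 * (dist (fst z) (snd z))\<^sup>2 - f (snd z)) ` (\<Omega> \<times> \<Omega>))"
    by (intro compact_imp_bounded compact_continuous_image compact_Times \<Omega> continuous_intros
        continuous_on_compose2[OF cf] subset_UNIV)
  have intG: "integrable \<mu> G"
  proof (rule integrable_bounded_on[OF M.finite_measure_axioms \<mu>D(2)])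
    show "AE x in \<mu>. x \<in> {x \<in> \<Omega>. T x \<in> \<Omega>}" using \<mu>D(4) T_in by eventually_elim simp
    have "G ` {x \<in> \<Omega>. T x \<in> \<Omega>} \<subseteq> (\<lambda>z. 1/2 * (dist (fst z) (snd z))\<^sup>2 - f (snd z)) ` (\<Omega> \<times> \<Omega>)"
      by (force simp: G_def image_iff)
    then show "bounded (G ` {x \<in> \<Omega>. T x \<in> \<Omega>})" using bounded bounded_subset by blast
  qed measurable
  have \<rho>0: "\<rho>0 \<in> prob_measures_on \<Omega>"
    unfolding \<rho>0_def by (rule distr_in_prob_measures_on[OF \<Omega> \<mu> T T_in])
  have gap: "integrable \<gamma> (\<lambda>z. c2_gap f T (fst z) (snd z))"
    "(LINT z|\<gamma>. c2_gap f T (fst z) (snd z))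
       = 1/2 * (LINT z|\<gamma>. (dist (fst z) (snd z))\<^sup>2) + lam * (LINT y|\<rho>. u y) - (LINT x|\<mu>. G x)"
    "0 \<le> (LINT z|\<gamma>. c2_gap f T (fst z) (snd z))"
    if \<rho>: "\<rho> \<in> prob_measures_on \<Omega>" and \<gamma>: "\<gamma> \<in> transport_plans \<mu> \<rho>" for \<gamma> \<rho>
  proof -
    note \<gamma>D = transport_planD[OF \<gamma> \<mu>D(1)]
    have i: "integrable \<gamma> (\<lambda>z. (dist (fst z) (snd z))\<^sup>2)" "integrable \<gamma> (\<lambda>z. u (snd z))"
      by (intro integrable_continuous_plan[OF \<Omega> \<mu> \<rho> \<gamma>] continuous_intros continuous_on_compose2[OF cu] subset_UNIV)+
    have G: "integrable \<gamma> (\<lambda>z. G (fst z))"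
    proof -
      have "distr \<gamma> borel fst = \<mu>" using \<gamma> by (simp add: transport_plans_def)
      then show ?thesis using intG \<gamma>D(3) integrable_distr[of fst \<gamma> borel G] by simp
    qed
    have eq: "c2_gap f T (fst z) (snd z) = 1/2 * (dist (fst z) (snd z))\<^sup>2 + lam * u (snd z) - G (fst z)" for z
      by (simp add: c2_gap_def G_def f_def)
    show "integrable \<gamma> (\<lambda>z. c2_gap f T (fst z) (snd z))" unfolding eq using i G by simp
    show "(LINT z|\<gamma>. c2_gap f T (fst z) (snd z))
       = 1/2 * (LINT z|\<gamma>. (dist (fst z) (snd z))\<^sup>2) + lam * (LINT y|\<rho>. u y) - (LINT x|\<mu>. G x)"
      unfolding eq using i G integral_transport_plan(1)[OF \<gamma> \<mu>D(1), of G] integral_transport_plan(2)[OF \<gamma> \<mu>D(1), of u]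
      by simp
    show "0 \<le> (LINT z|\<gamma>. c2_gap f T (fst z) (snd z))"
    proof (rule integral_nonneg_AE)
      show "AE z in \<gamma>. 0 \<le> c2_gap f T (fst z) (snd z)"
        using AE_transport_plan(1)[OF \<gamma> \<mu>D(1) min] AE_transport_plan(2)[OF \<gamma> \<mu>D(1) prob_measures_onD(4)[OF \<rho> \<Omega>]]
        by eventually_elim (rule c2_gap_nonneg[where T = T])
    qed
  qed
  have W1: "(LINT y|\<rho>. u y) - (LINT y|\<nu>. u y) \<le> wasserstein 1 \<rho> \<nu>" if \<rho>: "\<rho> \<in> prob_measures_on \<Omega>" for \<rho>
    unfolding wasserstein_1_eq[OF \<Omega> \<rho> \<nu>]
    by (intro cINF_greatest transport_plans_nonempty[OF \<Omega> \<rho> \<nu>] weak_duality[OF \<Omega> \<rho> \<nu> _ u])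
  have W2: "2 * ((LINT x|\<mu>. G x) - lam * (LINT y|\<rho>. u y)) \<le> (wasserstein 2 \<mu> \<rho>)\<^sup>2" if \<rho>: "\<rho> \<in> prob_measures_on \<Omega>" for \<rho>
    unfolding wasserstein_2_power2[OF \<Omega> \<mu> \<rho>]
  proof (intro cINF_greatest transport_plans_nonempty[OF \<Omega> \<mu> \<rho>])
    fix \<gamma> assume "\<gamma> \<in> transport_plans \<mu> \<rho>"
    from gap(2,3)[OF \<rho> this]
    show "2 * ((LINT x|\<mu>. G x) - lam * (LINT y|\<rho>. u y)) \<le> (LINT z|\<gamma>. (dist (fst z) (snd z))\<^sup>2)"
      by simp
  qed
  have lower: "V \<le> F \<rho>" if \<rho>: "\<rho> \<in> prob_measures_on \<Omega>" for \<rho>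
  proof -
    have "lam * ((LINT y|\<rho>. u y) - (LINT y|\<nu>. u y)) \<le> lam * wasserstein 1 \<rho> \<nu>"
      using lam by (intro mult_left_mono W1[OF \<rho>]) simp
    then show ?thesis using W2[OF \<rho>] unfolding F_def V_def by (simp add: algebra_simps)
  qed
  have upper: "F \<rho>0 \<le> V"
  proof -
    define \<gamma> where "\<gamma> = distr \<mu> borel (\<lambda>x. (x, T x))"
    have \<gamma>: "\<gamma> \<in> transport_plans \<mu> \<rho>0"
      using plan_of_maps(1)[OF \<mu>D(2), of "\<lambda>x. x" T] distr_id2[OF \<mu>D(2)[symmetric]] T
      by (simp add: \<gamma>_def \<rho>0_def)
    have c: "(\<lambda>z::'a \<times> 'a. (dist (fst z) (snd z))\<^sup>2) \<in> borel_measurable borel"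
      by (intro borel_measurable_continuous_onI continuous_intros)
    have "(wasserstein 2 \<mu> \<rho>0)\<^sup>2 \<le> (LINT z|\<gamma>. (dist (fst z) (snd z))\<^sup>2)"
      unfolding wasserstein_2_power2[OF \<Omega> \<mu> \<rho>0] by (intro cINF_lower bdd_below_cost \<gamma>) simp
    also have "\<dots> = (LINT x|\<mu>. (dist x (T x))\<^sup>2)"
      unfolding \<gamma>_def using plan_of_maps(2)[OF \<mu>D(2) _ T c, of "\<lambda>x. x"] by simp
    finally have 1: "(wasserstein 2 \<mu> \<rho>0)\<^sup>2 \<le> (LINT x|\<mu>. (dist x (T x))\<^sup>2)" .
    have int: "integrable \<mu> (\<lambda>x. u (T x))"
      using integrable_lipschitz_1[OF u \<rho>0 \<Omega>] unfolding \<rho>0_def by (subst (asm) integrable_distr_eq) auto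
    have "(LINT x|\<mu>. (dist x (T x))\<^sup>2) = (LINT x|\<mu>. 2 * (G x - lam * u (T x)))"
      by (intro Bochner_Integration.integral_cong) (auto simp: G_def f_def)
    also have "\<dots> = 2 * ((LINT x|\<mu>. G x) - lam * (LINT x|\<mu>. u (T x)))" using intG int by simp
    also have "(LINT x|\<mu>. u (T x)) = (LINT y|\<rho>0. u y)"
      unfolding \<rho>0_def by (rule integral_distr[symmetric]) auto
    finally show ?thesis
      using 1 mult_left_mono[OF dual less_imp_le[OF lam]]
      unfolding F_def V_def \<rho>0_def[symmetric] by (simp add: algebra_simps)
  qed
  have unique: "\<rho> = \<rho>0" if \<rho>: "\<rho> \<in> prob_measures_on \<Omega>" and le: "F \<rho> \<le> V" for \<rho>
    unfolding \<rho>0_def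
  proof (rule eq_distr_if_near_optimal_plans[OF \<Omega> \<mu> \<rho> cf T min])
    fix e :: real assume "0 < e"
    then have "(INF \<gamma>\<in>transport_plans \<mu> \<rho>. LINT z|\<gamma>. (dist (fst z) (snd z))\<^sup>2) < (wasserstein 2 \<mu> \<rho>)\<^sup>2 + 2 * e"
      by (simp add: wasserstein_2_power2[OF \<Omega> \<mu> \<rho>])
    then obtain \<gamma> where \<gamma>: "\<gamma> \<in> transport_plans \<mu> \<rho>"
      and lt: "(LINT z|\<gamma>. (dist (fst z) (snd z))\<^sup>2) < (wasserstein 2 \<mu> \<rho>)\<^sup>2 + 2 * e"
      by (subst (asm) cINF_less_iff[OF transport_plans_nonempty[OF \<Omega> \<mu> \<rho>]]) (auto intro: bdd_below_cost)
    have "lam * ((LINT y|\<rho>. u y) - (LINT y|\<nu>. u y)) \<le> lam * wasserstein 1 \<rho> \<nu>"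
      using lam by (intro mult_left_mono W1[OF \<rho>]) simp
    then have "(LINT z|\<gamma>. c2_gap f T (fst z) (snd z)) \<le> e"
      using le lt unfolding gap(2)[OF \<rho> \<gamma>] F_def V_def by (simp add: algebra_simps)
    then show "\<exists>\<gamma>\<in>transport_plans \<mu> \<rho>. integrable \<gamma> (\<lambda>z. c2_gap f T (fst z) (snd z)) \<and>
                 (LINT z|\<gamma>. c2_gap f T (fst z) (snd z)) \<le> e"
      using gap(1)[OF \<rho> \<gamma>] \<gamma> by blast
  qed
  have "is_arg_min F (\<lambda>\<rho>. \<rho> \<in> prob_measures_on \<Omega>) \<rho> \<longleftrightarrow> \<rho> = \<rho>0" for \<rho>
    using lower upper unique \<rho>0 unfolding is_arg_min_def by (meson leI le_less_trans not_le)
  then show ?thesis unfolding F_def \<rho>0_def by auto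
qed

theorem proposition3p5:
  fixes \<Omega> :: "'a::euclidean_space set"
    and \<mu> \<nu> :: "'a measure"
    and lam :: real
    and T0 T :: "'a \<Rightarrow> 'a"
    and u0 :: "'a \<Rightarrow> real"
  assumes "compact \<Omega>" and "convex \<Omega>"
    and "\<mu> \<in> prob_measures_on \<Omega>" and "\<nu> \<in> prob_measures_on \<Omega>"
    and "absolutely_continuous lborel \<mu>"
    and "ray_monotone_map \<Omega> \<mu> \<nu> T0"
    and "lam > 0"
    and "essinf \<mu> (\<lambda>x. norm (x - T0 x)) > ereal lam"
    and "kantorovich_potential \<Omega> \<mu> \<nu> u0"
    and "T \<in> borel_measurable borel"
    and "AE x in \<mu>. T x = x - gradient (c2_transform \<Omega> (\<lambda>y. - lam * u0 y)) x"
  shows "{\<rho>. is_arg_min (\<lambda>\<rho>. 1/2 * (wasserstein 2 \<mu> \<rho>)\<^sup>2 + lam * wasserstein 1 \<rho> \<nu>)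
              (\<lambda>\<rho>. \<rho> \<in> prob_measures_on \<Omega>) \<rho>} = {distr \<mu> borel T}"
proof -
  note \<Omega> = assms(1) and \<mu> = assms(3) and \<nu> = assms(4) and T[measurable] = assms(10)
  note \<mu>D = prob_measures_onD[OF \<mu> \<Omega>] and \<nu>D = prob_measures_onD[OF \<nu> \<Omega>]
  interpret M: prob_space \<mu> by (rule \<mu>D)
  note [measurable_cong] = \<mu>D(2)
  define u where "u x = u0 (closest_point \<Omega> x)" for x
  have u: "1-lipschitz_on UNIV u"
    unfolding u_def using \<Omega> assms(2,9) \<mu>D(5)
    by (intro lipschitz_compose_closest_point) (auto simp: kantorovich_potential_def is_arg_max_def)
  note [measurable] = lipschitz_1_borel_measurable[OF u]
  define f where "f y = - lam * u y" for y
  have cf: "continuous_on UNIV f"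
    unfolding f_def by (intro continuous_intros lipschitz_on_continuous_on[OF u])
  have f_eq: "c2_transform \<Omega> (\<lambda>y. - lam * u0 y) = c2_transform \<Omega> f"
    unfolding c2_transform_def f_def u_def by (intro ext INF_cong) (auto simp: closest_point_self)
  have S: "optimal_map_W1 \<mu> \<nu> T0" using assms(6) by (simp add: ray_monotone_map_def)
  then have T0[measurable]: "T0 \<in> borel_measurable borel" and T0\<nu>: "distr \<mu> borel T0 = \<nu>"
    by (auto simp: optimal_map_W1_def)
  have sat: "AE x in \<mu>. u x - u (T0 x) = dist x (T0 x)"
    unfolding u_def by (rule optimal_map_saturates_potential[OF \<Omega> assms(2) \<mu> \<nu> S assms(9)])
  have far: "AE x in \<mu>. lam < dist x (T0 x)"
  proof -
    obtain r where "ereal lam < r" and r: "AE x in \<mu>. r \<le> ereal (norm (x - T0 x))"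
      using assms(8) unfolding essinf_def less_Sup_iff by blast
    from r show ?thesis
      by eventually_elim (use \<open>ereal lam < r\<close> in \<open>auto simp: dist_norm dest: less_le_trans\<close>)
  qed
  have T0_in: "AE x in \<mu>. T0 x \<in> \<Omega>"
  proof -
    have "T0 \<in> \<mu> \<rightarrow>\<^sub>M borel" by measurable
    from AE_distrD[OF this, of "\<lambda>y. y \<in> \<Omega>"] show ?thesis using \<nu>D(4) unfolding T0\<nu> by blast
  qed
  have uniq: "AE x in \<mu>. \<exists>y. c2_minimizers \<Omega> f x = {y}"
    using AE_unique_c2_minimizer[OF \<Omega> \<mu>D(5) cf] \<mu>D(2) assms(5)
    by (intro absolutely_continuous_AE[of \<mu> lborel]) auto
  have min: "AE x in \<mu>. c2_minimizers \<Omega> f x = {T x}"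
    using uniq assms(11)
  proof eventually_elim
    case (elim x)
    then obtain y where y: "c2_minimizers \<Omega> f x = {y}" by blast
    have "gradient (c2_transform \<Omega> f) x = x - y"
      by (rule gradient_eq[OF GDERIV_c2_transform[OF \<Omega> \<mu>D(5) cf y]])
    then show ?case using elim(2) y unfolding f_eq by simp
  qed
  have T_sat: "AE x in \<mu>. u (T x) - u (T0 x) = dist (T x) (T0 x)"
    using min sat far T0_in \<mu>D(4)
  proof eventually_elim
    case (elim x)
    obtain y where "y \<in> c2_minimizers \<Omega> f x" "u y - u (T0 x) = dist y (T0 x)"
      using c2_minimizer_on_ray[OF assms(2) elim(5,4) u elim(2) assms(7) elim(3)]
      unfolding f_def by blast
    then show ?case using elim(1) by simp
  qed
  have T_in: "AE x in \<mu>. T x \<in> \<Omega>"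
    using min by eventually_elim (auto simp: c2_minimizers_def)
  have \<rho>0: "distr \<mu> borel T \<in> prob_measures_on \<Omega>"
    by (rule distr_in_prob_measures_on[OF \<Omega> \<mu> T T_in])
  have "wasserstein 1 (distr \<mu> borel T) \<nu>
      \<le> (LINT z|distr \<mu> borel (\<lambda>x. (T x, T0 x)). dist (fst z) (snd z))"
    unfolding wasserstein_1_eq[OF \<Omega> \<rho>0 \<nu>]
    using plan_of_maps(1)[OF \<mu>D(2) T T0] by (intro cINF_lower bdd_below_cost) (auto simp: T0\<nu>)
  also have "\<dots> = (LINT x|\<mu>. dist (T x) (T0 x))"
    using plan_of_maps(2)[OF \<mu>D(2) T T0 borel_measurable_continuous_onI[OF continuous_dist_pair]] by simp
  also have "\<dots> = (LINT x|\<mu>. u (T x) - u (T0 x))"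
    using T_sat by (intro integral_cong_AE) (auto elim!: eventually_mono)
  also have "\<dots> = (LINT x|\<mu>. u (T x)) - (LINT x|\<mu>. u (T0 x))"
  proof (rule Bochner_Integration.integral_diff)
    show "integrable \<mu> (\<lambda>x. u (T x))" "integrable \<mu> (\<lambda>x. u (T0 x))"
      using integrable_lipschitz_1[OF u \<rho>0 \<Omega>] integrable_lipschitz_1[OF u \<nu> \<Omega>] unfolding T0\<nu>[symmetric]
      by (auto simp: integrable_distr_eq)
  qed
  also have "\<dots> = (LINT y|distr \<mu> borel T. u y) - (LINT y|\<nu>. u y)"
    unfolding T0\<nu>[symmetric] by (simp add: integral_distr)
  finally show ?thesis
    using min unfolding f_def by (intro objective_characterization[OF \<Omega> \<mu> \<nu> assms(7) u T])
qed

end
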